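(* Let $\Phi$ be a Musielak-Orlicz function on $\Omega=(\alpha,\beta)$, $-\infty<\alpha<\beta<\infty$, with the Lebesgue measure. If the Musielak-Orlicz-Sobolev space $W^{1,\Phi}$ contains a subspace isomorphic to $\ell^\infty$, then $\Phi$ does not satisfy condition $\Delta_2$.
   Context: An Orlicz function is a convex function $\varphi:[0,\infty)\to[0,\infty)$, not identically $0$, with $\varphi(0)=\lim_{t\to0+}\varphi(t)=0$. A Musielak-Orlicz (MO) function is a function $\Phi:\Omega\times[0,\infty)\to[0,\infty)$ such that $\Phi(x,\cdot)$ is an Orlicz function for a.a. $x\in\Omega$ and $\Phi(\cdot,t)$ is measurable for every $t\ge0$. The space $L^\Phi=L^\Phi(\Omega)$ consists of all (classes of) measurable functions $f:\Omega\to\mathbb C$ with $I_\Phi(\lambda f)=\int_\Omega\Phi(x,\lambda|f(x)|)\,dx<\infty$ for some $\lambda>0$, with the Luxemburg norm $\|f\|_\Phi=\inf\{\lambda>0: I_\Phi(f/\lambda)\le1\}$. The space $W^{1,\Phi}=W^{1,\Phi}(\Omega)$ consists of all $f\in L^1_{loc}(\Omega)$ whose weak derivative $f'\in L^1_{loc}(\Omega)$ exists and $\|f\|_{1,\Phi}=\|f\|_\Phi+\|f'\|_\Phi<\infty$; it is equipped with the norm $\|\cdot\|_{1,\Phi}$. Condition $\Delta_2$: there exist $K>0$ and a non-negative $h\in L^1(\Omega)$ such that $\Phi(x,2t)\le K\Phi(x,t)+h(x)$ for a.a. $x\in\Omega$ and all $t\ge0$. "Isomorphic" means linearly homeomorphic.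 *)

theory Defs
  imports "HOL-Analysis.Analysis"
begin

definition orlicz_function :: "(real \<Rightarrow> real) \<Rightarrow> bool" where
  "orlicz_function \<phi> \<longleftrightarrow>
     (\<forall>t\<ge>0. 0 \<le> \<phi> t) \<and> convex_on {0..} \<phi> \<and> (\<exists>t\<ge>0. \<phi> t \<noteq> 0) \<and>
     \<phi> 0 = 0 \<and> (\<phi> \<longlongrightarrow> 0) (at_right 0)"

definition musielak_orlicz :: "real set \<Rightarrow> (real \<Rightarrow> real \<Rightarrow> real) \<Rightarrow> bool" where
  "musielak_orlicz \<Omega> \<Phi> \<longleftrightarrow>
     (\<forall>x\<in>\<Omega>. \<forall>t\<ge>0. 0 \<le> \<Phi> x t) \<and>
     (AE x in lebesgue_on \<Omega>. orlicz_function (\<Phi> x)) \<and>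
     (\<forall>t\<ge>0. (\<lambda>x. \<Phi> x t) \<in> borel_measurable (lebesgue_on \<Omega>))"

definition delta2 :: "real set \<Rightarrow> (real \<Rightarrow> real \<Rightarrow> real) \<Rightarrow> bool" where
  "delta2 \<Omega> \<Phi> \<longleftrightarrow>
     (\<exists>K h. K > 0 \<and> integrable (lebesgue_on \<Omega>) h \<and> (\<forall>x\<in>\<Omega>. 0 \<le> h x) \<and>
        (AE x in lebesgue_on \<Omega>. \<forall>t\<ge>0. \<Phi> x (2 * t) \<le> K * \<Phi> x t + h x))"

definition modular :: "real set \<Rightarrow> (real \<Rightarrow> real \<Rightarrow> real) \<Rightarrow> (real \<Rightarrow> complex) \<Rightarrow> ennreal" where
  "modular \<Omega> \<Phi> f = (\<integral>\<^sup>+x. ennreal (\<Phi> x (cmod (f x))) \<partial>lebesgue_on \<Omega>)"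

text \<open>The norm is extended-valued: since \<open>Inf {} = \<infinity>\<close>, a measurable function has
  finite norm precisely when it belongs to the Musielak-Orlicz space.\<close>

definition luxemburg_norm ::
  "real set \<Rightarrow> (real \<Rightarrow> real \<Rightarrow> real) \<Rightarrow> (real \<Rightarrow> complex) \<Rightarrow> ennreal" where
  "luxemburg_norm \<Omega> \<Phi> f =
     Inf {ennreal l |l. l > 0 \<and> modular \<Omega> \<Phi> (\<lambda>x. f x / complex_of_real l) \<le> 1}"

definition locally_integrable :: "real set \<Rightarrow> (real \<Rightarrow> complex) \<Rightarrow> bool" where
  "locally_integrable \<Omega> f \<longleftrightarrow>
     (\<forall>C. compact C \<and> C \<subseteq> \<Omega> \<longrightarrow> f absolutely_integrable_on C)"

definition test_function :: "real set \<Rightarrow> (real \<Rightarrow> real) \<Rightarrow> bool" where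
  "test_function \<Omega> \<phi> \<longleftrightarrow>
     (\<forall>n x. (deriv ^^ n) \<phi> differentiable at x) \<and>
     compact (closure {x. \<phi> x \<noteq> 0}) \<and> closure {x. \<phi> x \<noteq> 0} \<subseteq> \<Omega>"

definition is_weak_deriv :: "real set \<Rightarrow> (real \<Rightarrow> complex) \<Rightarrow> (real \<Rightarrow> complex) \<Rightarrow> bool" where
  "is_weak_deriv \<Omega> f g \<longleftrightarrow>
     locally_integrable \<Omega> f \<and> locally_integrable \<Omega> g \<and>
     (\<forall>\<phi>. test_function \<Omega> \<phi> \<longrightarrow>
        (LINT x|lebesgue_on \<Omega>. deriv \<phi> x *\<^sub>R f x) = - (LINT x|lebesgue_on \<Omega>. \<phi> x *\<^sub>R g x))"

text \<open>A weak derivative is unique up to null sets, so the norm below does not depend on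
  the choice made here.\<close>

definition weak_deriv :: "real set \<Rightarrow> (real \<Rightarrow> complex) \<Rightarrow> real \<Rightarrow> complex" where
  "weak_deriv \<Omega> f = (SOME g. is_weak_deriv \<Omega> f g)"

definition sobolev_norm ::
  "real set \<Rightarrow> (real \<Rightarrow> real \<Rightarrow> real) \<Rightarrow> (real \<Rightarrow> complex) \<Rightarrow> ennreal" where
  "sobolev_norm \<Omega> \<Phi> f = luxemburg_norm \<Omega> \<Phi> f + luxemburg_norm \<Omega> \<Phi> (weak_deriv \<Omega> f)"

definition sobolev_functions ::
  "real set \<Rightarrow> (real \<Rightarrow> real \<Rightarrow> real) \<Rightarrow> (real \<Rightarrow> complex) set" where
  "sobolev_functions \<Omega> \<Phi> =
     {f. locally_integrable \<Omega> f \<and> (\<exists>g. is_weak_deriv \<Omega> f g) \<and> sobolev_norm \<Omega> \<Phi> f < \<infinity>}"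

text \<open>The elements of the Sobolev space are classes of functions. Functions on \<open>\<Omega>\<close> are
  encoded as total functions whose values off \<open>\<Omega>\<close> are irrelevant.\<close>

definition ae_eq :: "real set \<Rightarrow> ((real \<Rightarrow> complex) \<times> (real \<Rightarrow> complex)) set" where
  "ae_eq \<Omega> = {(f, g). f \<in> borel_measurable (lebesgue_on \<Omega>) \<and>
                     g \<in> borel_measurable (lebesgue_on \<Omega>) \<and>
                     (AE x in lebesgue_on \<Omega>. f x = g x)}"

definition sobolev_space ::
  "real set \<Rightarrow> (real \<Rightarrow> real \<Rightarrow> real) \<Rightarrow> (real \<Rightarrow> complex) set set" where
  "sobolev_space \<Omega> \<Phi> = sobolev_functions \<Omega> \<Phi> // ae_eq \<Omega>"

definition class_add ::
  "real set \<Rightarrow> (real \<Rightarrow> complex) set \<Rightarrow> (real \<Rightarrow> complex) set \<Rightarrow> (real \<Rightarrow> complex) set" where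
  "class_add \<Omega> A B = (\<Union>f\<in>A. \<Union>g\<in>B. ae_eq \<Omega> `` {\<lambda>x. f x + g x})"

definition class_scale ::
  "real set \<Rightarrow> complex \<Rightarrow> (real \<Rightarrow> complex) set \<Rightarrow> (real \<Rightarrow> complex) set" where
  "class_scale \<Omega> c A = (\<Union>f\<in>A. ae_eq \<Omega> `` {\<lambda>x. c * f x})"

text \<open>\<^const>\<open>sobolev_norm\<close> is constant on each class, so \<^const>\<open>the_elem\<close> returns the norm of
  any representative.\<close>

definition class_norm ::
  "real set \<Rightarrow> (real \<Rightarrow> real \<Rightarrow> real) \<Rightarrow> (real \<Rightarrow> complex) set \<Rightarrow> real" where
  "class_norm \<Omega> \<Phi> A = enn2real (the_elem (sobolev_norm \<Omega> \<Phi> ` A))"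

definition sobolev_topology ::
  "real set \<Rightarrow> (real \<Rightarrow> real \<Rightarrow> real) \<Rightarrow> (real \<Rightarrow> complex) set topology" where
  "sobolev_topology \<Omega> \<Phi> =
     Metric_space.mtopology (sobolev_space \<Omega> \<Phi>)
       (\<lambda>A B. class_norm \<Omega> \<Phi> (class_add \<Omega> A (class_scale \<Omega> (- 1) B)))"

definition sobolev_subspace ::
  "real set \<Rightarrow> (real \<Rightarrow> real \<Rightarrow> real) \<Rightarrow> (real \<Rightarrow> complex) set set \<Rightarrow> bool" where
  "sobolev_subspace \<Omega> \<Phi> V \<longleftrightarrow>
     V \<noteq> {} \<and> V \<subseteq> sobolev_space \<Omega> \<Phi> \<and>
     (\<forall>A\<in>V. \<forall>B\<in>V. class_add \<Omega> A B \<in> V) \<and>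
     (\<forall>c. \<forall>A\<in>V. class_scale \<Omega> c A \<in> V)"

text \<open>As \<^typ>\<open>nat\<close> carries the discrete topology, its bounded continuous functions with the
  sup norm form the space of all bounded complex sequences. The library only provides the
  scalar multiplication by reals.\<close>

type_synonym linf = "nat \<Rightarrow>\<^sub>C complex"

definition linf_scale :: "complex \<Rightarrow> linf \<Rightarrow> linf" where
  "linf_scale c x = Bcontfun (\<lambda>n. c * apply_bcontfun x n)"

lemma apply_linf_scale [simp]:
  "apply_bcontfun (linf_scale c x) n = c * apply_bcontfun x n"
proof -
  have "bounded ((\<lambda>z. c * z) ` range (apply_bcontfun x))"
    by (intro bounded_linear_image bounded_linear_mult_right bounded_apply_bcontfun)
  then have "(\<lambda>n. c * apply_bcontfun x n) \<in> bcontfun"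
    by (simp add: bcontfun_def image_image)
  then show ?thesis
    by (simp add: linf_scale_def Bcontfun_inverse)
qed

definition contains_linf_copy :: "real set \<Rightarrow> (real \<Rightarrow> real \<Rightarrow> real) \<Rightarrow> bool" where
  "contains_linf_copy \<Omega> \<Phi> \<longleftrightarrow>
     (\<exists>V (T :: linf \<Rightarrow> (real \<Rightarrow> complex) set).
        sobolev_subspace \<Omega> \<Phi> V \<and>
        (\<forall>x y. T (x + y) = class_add \<Omega> (T x) (T y)) \<and>
        (\<forall>c x. T (linf_scale c x) = class_scale \<Omega> c (T x)) \<and>
        homeomorphic_map euclidean (subtopology (sobolev_topology \<Omega> \<Phi>) V) T)"

end

theory Submission
  imports Defs
begin

text \<open>
  The reason is that, under \<open>\<Delta>\<^sub>2\<close>, a sequence in \<open>W\<^sup>1\<^sup>,\<^sup>\<Phi>\<close> whose finite signed sums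
  \<open>\<plusminus>f\<^sub>0 \<plusminus> \<dots> \<plusminus> f\<^bsub>n-1\<^esub>\<close> all have norm below \<open>1\<close> must tend to \<open>0\<close>, whereas the unit vectors of
  \<open>\<ell>\<^sup>\<infinity>\<close> have bounded signed sums and norm \<open>1\<close>. An isomorphic embedding \<open>T\<close> of \<open>\<ell>\<^sup>\<infinity>\<close> would carry
  suitable multiples of the unit vectors to such a sequence, and continuity of the inverse of \<open>T\<close>
  then gives a contradiction. The obstruction thus lies in the copy of \<open>c\<^sub>0\<close> inside \<open>\<ell>\<^sup>\<infinity>\<close>.

  The norm of \<open>f\<close> in \<open>W\<^sup>1\<^sup>,\<^sup>\<Phi>\<close> is the sum of the Luxemburg norms of \<open>f\<close> and \<open>f'\<close>, so the first
  claim reduces to \<open>L\<^sup>\<Phi>\<close> (lemma \<open>luxemburg_norm_tendsto_0_if_signs_bounded\<close>). All signed sums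
  have modular at most \<open>1\<close>. Averaging the modulars over the signs, Jensen's inequality for the convex
  function \<open>\<Phi>(x,\<cdot>)\<close> and Khinchine's inequality (lemma \<open>khinchine\<close>) give
  \<open>\<integral> \<Phi>(x, \<sigma>\<^sub>n(x)) dx \<le> 1\<close> for half the square function
  \<open>\<sigma>\<^sub>n = (\<Sum>i<n. \<bar>f\<^sub>i\<bar>\<^sup>2)\<^sup>1\<^sup>/\<^sup>2 / 2\<close>. Monotone convergence shows that \<open>\<Sum>i. \<bar>f\<^sub>i(x)\<bar>\<^sup>2\<close> converges almost
  everywhere, so \<open>f\<^sub>i \<rightarrow> 0\<close> almost everywhere, and that all the functions \<open>\<Phi>(x, \<bar>f\<^sub>i\<bar> / 2)\<close> lie below
  one integrable function. Condition \<open>\<Delta>\<^sub>2\<close> turns this into an integrable bound for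
  \<open>\<Phi>(x, \<bar>f\<^sub>i\<bar> / l)\<close>, for every \<open>l > 0\<close>, and dominated convergence gives norm convergence to \<open>0\<close>.

  Two things have to be supplied before the argument can be applied to equivalence classes. Weak
  derivatives must be unique almost everywhere, so that the derivative of a signed sum is the signed
  sum of the derivatives; this is the fundamental lemma of the calculus of variations
  (\<open>fundamental_lemma\<close>), for which smooth bump functions are built from
  \<open>exp(-1/x)\<close>. And the norm must induce a metric on the classes (\<open>sobolev_Metric_space\<close>), because
  the open sets of the topology can only be described in terms of balls when it does.
\<close>

section \<open>Smooth bump functions\<close>

text \<open>For constant \<open>p\<close> this is the standard smooth function with a zero of infinite order. Letting
  \<open>p\<close> range over all polynomials makes the family closed under differentiation.\<close>

definition flat_exp :: "real poly \<Rightarrow> real \<Rightarrow> real" where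
  "flat_exp p x = (if 0 < x then poly p (1 / x) * exp (- (1 / x)) else 0)"

lemma flat_exp_nonpos: "x \<le> 0 \<Longrightarrow> flat_exp p x = 0"
  by (simp add: flat_exp_def)

lemma poly_exp_decay: "((\<lambda>y::real. poly p y * exp (- y)) \<longlongrightarrow> 0) at_top"
proof -
  have "((\<lambda>y::real. y ^ k * poly p y * exp (- y)) \<longlongrightarrow> 0) at_top" for k
  proof (induction p arbitrary: k)
    case (pCons a p)
    have "((\<lambda>y::real. a * (y ^ k / exp y) + y ^ Suc k * poly p y * exp (- y)) \<longlongrightarrow> a * 0 + 0) at_top"
      by (intro tendsto_add tendsto_mult tendsto_const tendsto_power_div_exp_0 pCons.IH)
    then show ?case
      by (simp add: algebra_simps exp_minus divide_inverse)
  qed simp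
  from this[of 0] show ?thesis by simp
qed

text \<open>At the origin the exponential beats every power of \<open>1/h\<close>; this is what makes the extension
  by \<open>0\<close> differentiable there.\<close>

lemma flat_exp_tendsto_0: "((\<lambda>h. flat_exp p h / h) \<longlongrightarrow> 0) (at 0)"
proof -
  have "((\<lambda>h. poly (monom 1 1 * p) (inverse h) * exp (- inverse h)) \<longlongrightarrow> 0) (at_right (0::real))"
    using filterlim_compose[OF poly_exp_decay filterlim_inverse_at_top_right] .
  moreover have "\<forall>\<^sub>F h in at_right (0::real).
      poly (monom 1 1 * p) (inverse h) * exp (- inverse h) = flat_exp p h / h"
    unfolding eventually_at_right_field
    by (intro exI[of _ 1]) (auto simp: flat_exp_def poly_monom divide_inverse)
  ultimately have r: "((\<lambda>h. flat_exp p h / h) \<longlongrightarrow> 0) (at_right 0)"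
    by (rule Lim_transform_eventually)
  have "\<forall>\<^sub>F h in at_left (0::real). 0 = flat_exp p h / h"
    unfolding eventually_at_left_field
    by (intro exI[of _ "-1"]) (auto simp: flat_exp_def)
  then have l: "((\<lambda>h. flat_exp p h / h) \<longlongrightarrow> 0) (at_left 0)"
    by (rule Lim_transform_eventually[OF tendsto_const])
  show ?thesis using l r by (simp add: filterlim_at_split)
qed

lemma flat_exp_has_derivative:
  "(flat_exp p has_real_derivative flat_exp (monom 1 2 * (p - pderiv p)) x) (at x)"
proof -
  consider "x > 0" | "x < 0" | "x = 0" by linarith
  then show ?thesis
  proof cases
    case 1
    have "((\<lambda>x. poly p (1 / x) * exp (- (1 / x))) has_real_derivative
        flat_exp (monom 1 2 * (p - pderiv p)) x) (at x)"
      using 1 by (auto intro!: derivative_eq_intros DERIV_chain2[OF poly_DERIV]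
          simp: flat_exp_def poly_monom field_simps power2_eq_square)
    then show ?thesis
      by (rule has_field_derivative_transform_within_open[where S = "{0<..}"])
        (use 1 in \<open>auto simp: flat_exp_def\<close>)
  next
    case 2
    have "((\<lambda>x. 0) has_real_derivative flat_exp (monom 1 2 * (p - pderiv p)) x) (at x)"
      using 2 by (simp add: flat_exp_def)
    then show ?thesis
      by (rule has_field_derivative_transform_within_open[where S = "{..<0}"])
        (use 2 in \<open>auto simp: flat_exp_def\<close>)
  next
    case 3
    then show ?thesis
      using flat_exp_tendsto_0[of p] by (simp add: DERIV_def flat_exp_nonpos)
  qed
qed

text \<open>Products of two flat functions are needed for bumps. Instead of a Leibniz formula for higher
  derivatives, it suffices that the algebra generated by the flat functions is closed under
  differentiation: then all its members are smooth.\<close>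

inductive_set flat_algebra :: "(real \<Rightarrow> real) set" where
  base: "(\<lambda>x. flat_exp p (c * x + d)) \<in> flat_algebra"
| scale: "f \<in> flat_algebra \<Longrightarrow> (\<lambda>x. k * f x) \<in> flat_algebra"
| add: "f \<in> flat_algebra \<Longrightarrow> g \<in> flat_algebra \<Longrightarrow> (\<lambda>x. f x + g x) \<in> flat_algebra"
| mult: "f \<in> flat_algebra \<Longrightarrow> g \<in> flat_algebra \<Longrightarrow> (\<lambda>x. f x * g x) \<in> flat_algebra"

lemma flat_algebra_derivative:
  "f \<in> flat_algebra \<Longrightarrow> \<exists>f'\<in>flat_algebra. \<forall>x. (f has_real_derivative f' x) (at x)"
proof (induction rule: flat_algebra.induct)
  case (base p c d)
  have "((\<lambda>x. flat_exp p (c * x + d)) has_real_derivative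
      c * flat_exp (monom 1 2 * (p - pderiv p)) (c * x + d)) (at x)" for x
  proof -
    have "((\<lambda>x. c * x + d) has_real_derivative c) (at x)"
      by (auto intro!: derivative_eq_intros)
    from DERIV_chain2[OF flat_exp_has_derivative this] show ?thesis
      by (simp only: mult.commute[of _ c])
  qed
  then show ?case
    by (intro bexI[where x = "\<lambda>x. c * flat_exp (monom 1 2 * (p - pderiv p)) (c * x + d)"])
      (auto intro: flat_algebra.intros)
next
  case (scale f k)
  then obtain f' where "f' \<in> flat_algebra" "\<forall>x. (f has_real_derivative f' x) (at x)" by blast
  then show ?case
    by (intro bexI[where x = "\<lambda>x. k * f' x"])
      (auto intro!: flat_algebra.intros derivative_eq_intros)
next
  case (add f g)
  then obtain f' g' where "f' \<in> flat_algebra" "\<forall>x. (f has_real_derivative f' x) (at x)"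
     "g' \<in> flat_algebra" "\<forall>x. (g has_real_derivative g' x) (at x)" by blast
  then show ?case
    by (intro bexI[where x = "\<lambda>x. f' x + g' x"])
      (auto intro!: flat_algebra.intros derivative_eq_intros)
next
  case (mult f g)
  then obtain f' g' where "f' \<in> flat_algebra" "\<forall>x. (f has_real_derivative f' x) (at x)"
     "g' \<in> flat_algebra" "\<forall>x. (g has_real_derivative g' x) (at x)" by blast
  then show ?case using mult.hyps
    by (intro bexI[where x = "\<lambda>x. f' x * g x + f x * g' x"])
      (auto intro!: flat_algebra.intros derivative_eq_intros)
qed

lemma flat_algebra_higher_deriv: "f \<in> flat_algebra \<Longrightarrow> (deriv ^^ n) f \<in> flat_algebra"
proof (induction n)
  case (Suc n)
  then obtain g where "g \<in> flat_algebra" "\<forall>x. ((deriv ^^ n) f has_real_derivative g x) (at x)"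
    using flat_algebra_derivative by blast
  moreover from this have "deriv ((deriv ^^ n) f) = g" by (auto intro: DERIV_imp_deriv)
  ultimately show ?case by simp
qed simp

lemma flat_algebra_smooth: "f \<in> flat_algebra \<Longrightarrow> (deriv ^^ n) f differentiable at x"
  using flat_algebra_derivative[OF flat_algebra_higher_deriv]
  by (meson real_differentiable_def)

definition bump :: "real \<Rightarrow> real \<Rightarrow> nat \<Rightarrow> real \<Rightarrow> real" where
  "bump a b n x = flat_exp 1 (real n * x + - (real n * a)) * flat_exp 1 (- real n * x + real n * b)"

lemma bump_eq:
  "bump a b n x =
    (if n > 0 \<and> a < x \<and> x < b then exp (- (1 / (real n * (x - a)))) * exp (- (1 / (real n * (b - x)))) else 0)"
proof -
  have "real n * x + - (real n * a) = real n * (x - a)" "- real n * x + real n * b = real n * (b - x)"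
    by (simp_all add: algebra_simps)
  then show ?thesis by (simp add: bump_def flat_exp_def zero_less_mult_iff)
qed

lemma bump_bounds: "0 \<le> bump a b n x \<and> bump a b n x \<le> 1"
  by (auto simp: bump_eq intro!: mult_le_one)

lemma test_function_bump:
  assumes "\<alpha> < a" "b < \<beta>"
  shows "test_function {\<alpha><..<\<beta>} (bump a b n)"
proof -
  have "(\<lambda>x. flat_exp 1 (real n * x + - (real n * a)) * flat_exp 1 (- real n * x + real n * b)) \<in> flat_algebra"
    by (intro flat_algebra.intros)
  then have "bump a b n \<in> flat_algebra" by (simp add: bump_def[abs_def])
  moreover have sub: "closure {x. bump a b n x \<noteq> 0} \<subseteq> {a..b}"
    by (rule closure_minimal) (auto simp: bump_eq)
  moreover have "compact (closure {x. bump a b n x \<noteq> 0})"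
    using compact_Int_closed[OF compact_Icc[of a b] closed_closure] sub
    by (metis inf.absorb_iff2)
  ultimately show ?thesis
    using assms by (auto simp: test_function_def flat_algebra_smooth)
qed

text \<open>As \<open>n\<close> grows, the bump fills the open interval pointwise while staying between \<open>0\<close> and \<open>1\<close>, with
  fixed support. Dominated convergence therefore turns integrals against bumps into integrals over
  intervals.\<close>

lemma bump_tendsto: "(\<lambda>n. bump a b n x) \<longlonglongrightarrow> indicator {a<..<b} x"
proof (cases "a < x \<and> x < b")
  case True
  have lim: "(\<lambda>n. 1 / (real n * c)) \<longlonglongrightarrow> 0" for c :: real
    using tendsto_mult[OF lim_1_over_n tendsto_const[of "1 / c"]] by simp
  have "(\<lambda>n. exp (- (1 / (real n * (x - a)))) * exp (- (1 / (real n * (b - x))))) \<longlonglongrightarrow> exp (- 0) * exp (- 0)"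
    by (intro tendsto_intros lim)
  then have "(\<lambda>n. exp (- (1 / (real n * (x - a)))) * exp (- (1 / (real n * (b - x))))) \<longlonglongrightarrow> indicator {a<..<b} x"
    using True by simp
  moreover have "\<forall>\<^sub>F n in sequentially.
      exp (- (1 / (real n * (x - a)))) * exp (- (1 / (real n * (b - x)))) = bump a b n x"
    using eventually_gt_at_top[of 0] by eventually_elim (use True in \<open>auto simp: bump_eq\<close>)
  ultimately show ?thesis by (rule Lim_transform_eventually)
next
  case False
  then have "(\<lambda>n. bump a b n x) = (\<lambda>n. indicator {a<..<b} x)" by (auto simp: bump_eq)
  then show ?thesis by simp
qed

section \<open>Weak derivatives\<close>

text \<open>An open interval is a countable union of compact ones, and local integrability gives
  measurability on each of them.\<close>

lemma locally_integrable_measurable: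
  assumes "locally_integrable {\<alpha><..<\<beta>} f"
  shows "f \<in> borel_measurable (lebesgue_on {\<alpha><..<\<beta>})"
proof (rule measurable_piecewise_restrict)
  let ?K = "\<lambda>n. {\<alpha> + 1 / real (Suc n)..\<beta> - 1 / real (Suc n)}"
  show "countable (range ?K)" by simp
  have sub: "?K n \<subseteq> {\<alpha><..<\<beta>}" for n
  proof
    fix x assume "x \<in> ?K n"
    moreover have "1 / real (Suc n) > 0" by simp
    ultimately show "x \<in> {\<alpha><..<\<beta>}" unfolding atLeastAtMost_iff greaterThanLessThan_iff by linarith
  qed
  have eq: "?K n \<inter> {\<alpha><..<\<beta>} = ?K n" "{\<alpha><..<\<beta>} \<inter> ?K n = ?K n" for n
    using sub by blast+
  show "S \<inter> space (lebesgue_on {\<alpha><..<\<beta>}) \<in> sets (lebesgue_on {\<alpha><..<\<beta>})" if "S \<in> range ?K" for S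
    using that eq by (auto simp: sets_restrict_space_iff)
  show "space (lebesgue_on {\<alpha><..<\<beta>}) \<subseteq> (\<Union>(range ?K))"
  proof
    fix x assume "x \<in> space (lebesgue_on {\<alpha><..<\<beta>})"
    then have "0 < min (x - \<alpha>) (\<beta> - x)" by simp
    then obtain n where "1 / real (Suc n) < min (x - \<alpha>) (\<beta> - x)"
      using nat_approx_posE by blast
    then show "x \<in> (\<Union>(range ?K))" by (auto intro!: exI[of _ n])
  qed
  show "f \<in> borel_measurable (restrict_space (lebesgue_on {\<alpha><..<\<beta>}) S)" if S: "S \<in> range ?K" for S
  proof -
    obtain n where n: "S = ?K n" using S by blast
    have "f absolutely_integrable_on ?K n"
      using assms sub by (auto simp: locally_integrable_def)
    then show ?thesis
      unfolding n using absolutely_integrable_imp_borel_measurable[where f = f and S = "?K n"]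
      by (subst restrict_restrict_space) (simp_all only: eq, auto)
  qed
qed

lemma locally_integrable_add:
  "locally_integrable \<Omega> f \<Longrightarrow> locally_integrable \<Omega> g \<Longrightarrow> locally_integrable \<Omega> (\<lambda>x. f x + g x)"
  by (auto simp: locally_integrable_def intro: set_integral_add(1))

lemma locally_integrable_cmult:
  "locally_integrable \<Omega> f \<Longrightarrow> locally_integrable \<Omega> (\<lambda>x. c * f x)"
  by (auto simp: locally_integrable_def)

lemma integrable_continuous_scaleR:
  fixes \<psi> :: "real \<Rightarrow> real"
  assumes "locally_integrable \<Omega> g" "\<Omega> \<in> sets lebesgue" "compact C" "C \<subseteq> \<Omega>"
    and "continuous_on UNIV \<psi>" and out: "\<And>x. x \<notin> C \<Longrightarrow> \<psi> x = 0"
  shows "integrable (lebesgue_on \<Omega>) (\<lambda>x. \<psi> x *\<^sub>R g x)"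
proof -
  have cont: "continuous_on C \<psi>" using assms(5) continuous_on_subset by blast
  have "(\<lambda>x. \<psi> x *\<^sub>R g x) absolutely_integrable_on C"
  proof (rule absolutely_integrable_bounded_measurable_product[of "(*\<^sub>R)"])
    show "bilinear ((*\<^sub>R) :: real \<Rightarrow> complex \<Rightarrow> complex)"
      by (auto simp: bilinear_def linear_iff scaleR_add_left scaleR_add_right)
    show "C \<in> sets lebesgue" using assms(3) by (simp add: borel_compact)
    then show "\<psi> \<in> borel_measurable (lebesgue_on C)"
      using cont by (simp add: continuous_imp_measurable_on_sets_lebesgue)
    show "bounded (\<psi> ` C)"
      using cont assms(3) by (simp add: compact_continuous_image compact_imp_bounded)
    show "g absolutely_integrable_on C" using assms by (simp add: locally_integrable_def)
  qed
  moreover have "(\<lambda>x. indicator C x *\<^sub>R \<psi> x *\<^sub>R g x) = (\<lambda>x. indicator \<Omega> x *\<^sub>R \<psi> x *\<^sub>R g x)"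
    using assms(4) out by (fastforce simp: indicator_def)
  ultimately show ?thesis
    using assms(2) by (simp add: integrable_restrict_space set_integrable_def)
qed

lemma test_function_support:
  assumes "test_function \<Omega> \<phi>"
  obtains C where "compact C" "C \<subseteq> \<Omega>" "\<And>x. x \<notin> C \<Longrightarrow> \<phi> x = 0" "\<And>x. x \<notin> C \<Longrightarrow> deriv \<phi> x = 0"
    "continuous_on UNIV \<phi>" "continuous_on UNIV (deriv \<phi>)"
proof -
  define C where "C = closure {x. \<phi> x \<noteq> 0}"
  have C: "compact C" "C \<subseteq> \<Omega>" using assms by (auto simp: test_function_def C_def)
  have 0: "\<phi> x = 0" if "x \<notin> C" for x
    using that closure_subset[of "{x. \<phi> x \<noteq> 0}"] by (auto simp: C_def)
  have 1: "deriv \<phi> x = 0" if "x \<notin> C" for x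
  proof -
    have "((\<lambda>_. 0) has_real_derivative 0) (at x)" by simp
    then have "(\<phi> has_real_derivative 0) (at x)"
    proof (rule has_field_derivative_transform_within_open)
      show "open (- C)" by (simp add: C_def open_Compl)
      show "x \<in> - C" using that by simp
      show "0 = \<phi> y" if "y \<in> - C" for y using 0 that by simp
    qed
    then show ?thesis by (rule DERIV_imp_deriv)
  qed
  have diff: "(deriv ^^ 0) \<phi> differentiable at x" "(deriv ^^ 1) \<phi> differentiable at x" for x
    using assms unfolding test_function_def by blast+
  have "continuous_on UNIV \<phi>" "continuous_on UNIV (deriv \<phi>)"
    using diff by (auto intro!: continuous_at_imp_continuous_on differentiable_imp_continuous_within)
  with C 0 1 show thesis by (rule that)
qed

lemma integrable_test_function:
  assumes "test_function \<Omega> \<phi>" "locally_integrable \<Omega> g" "\<Omega> \<in> sets lebesgue"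
  shows "integrable (lebesgue_on \<Omega>) (\<lambda>x. \<phi> x *\<^sub>R g x)"
    and "integrable (lebesgue_on \<Omega>) (\<lambda>x. deriv \<phi> x *\<^sub>R g x)"
proof -
  obtain C where C: "compact C" "C \<subseteq> \<Omega>" "\<And>x. x \<notin> C \<Longrightarrow> \<phi> x = 0" "\<And>x. x \<notin> C \<Longrightarrow> deriv \<phi> x = 0"
    "continuous_on UNIV \<phi>" "continuous_on UNIV (deriv \<phi>)"
    by (rule test_function_support[OF assms(1)]) (rule that)
  show "integrable (lebesgue_on \<Omega>) (\<lambda>x. \<phi> x *\<^sub>R g x)"
    using assms(2,3) C(1,2,5,3) by (rule integrable_continuous_scaleR)
  show "integrable (lebesgue_on \<Omega>) (\<lambda>x. deriv \<phi> x *\<^sub>R g x)"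
    using assms(2,3) C(1,2,6,4) by (rule integrable_continuous_scaleR)
qed

lemma is_weak_deriv_add:
  assumes "is_weak_deriv \<Omega> f f'" "is_weak_deriv \<Omega> g g'" "\<Omega> \<in> sets lebesgue"
  shows "is_weak_deriv \<Omega> (\<lambda>x. f x + g x) (\<lambda>x. f' x + g' x)"
proof -
  have "(LINT x|lebesgue_on \<Omega>. deriv \<phi> x *\<^sub>R (f x + g x)) = - (LINT x|lebesgue_on \<Omega>. \<phi> x *\<^sub>R (f' x + g' x))"
    if "test_function \<Omega> \<phi>" for \<phi>
    using assms that
    by (simp add: is_weak_deriv_def scaleR_add_right integrable_test_function)
  then show ?thesis using assms by (simp add: is_weak_deriv_def locally_integrable_add)
qed

lemma is_weak_deriv_cmult:
  assumes "is_weak_deriv \<Omega> f f'"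
  shows "is_weak_deriv \<Omega> (\<lambda>x. c * f x) (\<lambda>x. c * f' x)"
proof -
  have "(LINT x|lebesgue_on \<Omega>. deriv \<phi> x *\<^sub>R (c * f x)) = - (LINT x|lebesgue_on \<Omega>. \<phi> x *\<^sub>R (c * f' x))"
    if "test_function \<Omega> \<phi>" for \<phi>
  proof -
    have "(LINT x|lebesgue_on \<Omega>. deriv \<phi> x *\<^sub>R f x) = - (LINT x|lebesgue_on \<Omega>. \<phi> x *\<^sub>R f' x)"
      using assms that by (simp add: is_weak_deriv_def)
    then show ?thesis by (simp flip: mult_scaleR_right)
  qed
  then show ?thesis using assms by (simp add: is_weak_deriv_def locally_integrable_cmult)
qed

text \<open>The sets over which \<open>w\<close> integrates to \<open>0\<close> contain the compact intervals and are closed under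
  complements and disjoint countable unions, so they include all Borel sets. The function is first
  replaced by a Borel measurable one, because Lebesgue measurable sets are not generated by
  intervals.\<close>

lemma AE_zero_if_interval_integrals_zero:
  fixes w :: "real \<Rightarrow> complex"
  assumes "integrable lebesgue w"
    and zero: "\<And>a b. (LINT x|lebesgue. indicator {a..b} x *\<^sub>R w x) = 0"
  shows "AE x in lebesgue. w x = 0"
proof -
  obtain v where v: "v \<in> borel_measurable lborel" "AE x in lborel. w x = v x"
  proof -
    have "(\<lambda>x. Re (w x)) \<in> borel_measurable lebesgue" "(\<lambda>x. Im (w x)) \<in> borel_measurable lebesgue"
      using assms(1) by auto
    then obtain r s where "r \<in> borel_measurable lborel" "AE x in lborel. Re (w x) = r x"
        and "s \<in> borel_measurable lborel" "AE x in lborel. Im (w x) = s x"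
      using completion_ex_borel_measurable_real[of "\<lambda>x. Re (w x)" lborel]
        completion_ex_borel_measurable_real[of "\<lambda>x. Im (w x)" lborel] by blast
    moreover from this have "AE x in lborel. w x = Complex (r x) (s x)"
      by (auto simp: complex_eq_iff)
    moreover have "(\<lambda>x. Complex (r x) (s x)) = (\<lambda>x. complex_of_real (r x) + \<i> * complex_of_real (s x))"
      by (simp add: Complex_eq)
    ultimately show ?thesis by (intro that[of "\<lambda>x. Complex (r x) (s x)"]) auto
  qed
  have vL: "v \<in> borel_measurable lebesgue" using v(1) by (simp add: measurable_completion)
  have ae: "AE x in lebesgue. w x = v x" using v(2) by (rule AE_completion)
  have "integrable lebesgue v"
    using integrable_cong_AE[OF _ vL ae] assms(1) by auto
  then have int: "integrable lborel v" using v(1) by (simp add: integrable_completion)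
  have zero': "(LINT x|lborel. indicator {a..b} x *\<^sub>R v x) = 0" for a b
  proof -
    have "(LINT x|lborel. indicator {a..b} x *\<^sub>R v x) = (LINT x|lebesgue. indicator {a..b} x *\<^sub>R v x)"
      using v(1) by (intro integral_completion[symmetric]) auto
    also have "\<dots> = (LINT x|lebesgue. indicator {a..b} x *\<^sub>R w x)"
    proof (intro integral_cong_AE borel_measurable_scaleR borel_measurable_indicator)
      show "AE x in lebesgue. indicator {a..b} x *\<^sub>R v x = indicator {a..b} x *\<^sub>R w x"
        using ae by eventually_elim simp
    qed (use vL assms(1) in auto)
    finally show ?thesis using zero by simp
  qed
  \<comment> \<open>closure under complements requires that the integral over the whole line vanish too\<close>
  have whole: "(LINT x|lborel. v x) = 0"
  proof (rule LIMSEQ_unique[OF _ tendsto_const])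
    have "(\<lambda>n. LINT x|lborel. indicator {- real n..real n} x *\<^sub>R v x) \<longlonglongrightarrow> (LINT x|lborel. v x)"
    proof (rule integral_dominated_convergence[where w = "\<lambda>x. norm (v x)"])
      show "AE x in lborel. (\<lambda>n. indicator {- real n..real n} x *\<^sub>R v x) \<longlonglongrightarrow> v x"
      proof (rule AE_I2)
        fix x
        have "\<forall>\<^sub>F n in sequentially. v x = indicator {- real n..real n} x *\<^sub>R v x"
          using eventually_ge_at_top[of "nat \<lceil>\<bar>x\<bar>\<rceil>"]
          by eventually_elim (simp add: indicator_def, linarith)
        then show "(\<lambda>n. indicator {- real n..real n} x *\<^sub>R v x) \<longlonglongrightarrow> v x"
          by (rule Lim_transform_eventually[OF tendsto_const])
      qed
    qed (use v(1) int in \<open>auto simp: indicator_def\<close>)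
    then show "(\<lambda>n. 0) \<longlonglongrightarrow> (LINT x|lborel. v x)" by (simp add: zero')
  qed
  have "set_lebesgue_integral lborel A v = 0" if "A \<in> sets lborel" for A
  proof -
    have "A \<in> sets borel" using that by simp
    then show ?thesis
    proof (induction rule: borel_set_induct)
      case (interval a b)
      then show ?case using zero' by (simp add: set_lebesgue_integral_def)
    next
      case (compl A)
      have "set_lebesgue_integral lborel (- A) v = (LINT x|lborel. v x - indicator A x *\<^sub>R v x)"
        unfolding set_lebesgue_integral_def by (intro Bochner_Integration.integral_cong) (auto simp: indicator_def)
      also have "\<dots> = (LINT x|lborel. v x) - set_lebesgue_integral lborel A v"
        unfolding set_lebesgue_integral_def
        by (intro Bochner_Integration.integral_diff int integrable_mult_indicator) (use compl in auto)
      finally show ?case using compl whole by simp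
    next
      case (union F)
      have "set_integrable lborel (\<Union>(range F)) v"
        unfolding set_integrable_def by (intro integrable_mult_indicator int) (use union in auto)
      then have "set_lebesgue_integral lborel (\<Union>(range F)) v = (\<Sum>i. set_lebesgue_integral lborel (F i) v)"
        using union by (intro lebesgue_integral_countable_add) (auto simp: disjoint_family_on_def)
      then show ?case using union by simp
    qed (simp add: set_lebesgue_integral_def)
  qed
  then have "AE x in lborel. v x = 0" by (rule sigma_finite_measure.density_zero[OF lborel.sigma_finite_measure_axioms int])
  then have "AE x in lebesgue. v x = 0" by (rule AE_completion)
  with ae show ?thesis by eventually_elim simp
qed

text \<open>The fundamental lemma of the calculus of variations in one dimension: testing against bumps shows
  that all integrals of \<open>g\<close> over compact subintervals vanish.\<close>

lemma fundamental_lemma: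
  assumes g: "locally_integrable {\<alpha><..<\<beta>} g"
    and zero: "\<And>\<phi>. test_function {\<alpha><..<\<beta>} \<phi> \<Longrightarrow> (LINT x|lebesgue_on {\<alpha><..<\<beta>}. \<phi> x *\<^sub>R g x) = 0"
  shows "AE x in lebesgue_on {\<alpha><..<\<beta>}. g x = 0"
proof -
  let ?\<Omega> = "{\<alpha><..<\<beta>}"
  have setint: "set_integrable lebesgue {a..b} g" if "\<alpha> < a" "b < \<beta>" for a b
  proof -
    have "{a..b} \<subseteq> {\<alpha><..<\<beta>}" using that by auto
    then show ?thesis using g by (simp add: locally_integrable_def)
  qed
  have interval: "(LINT x|lebesgue. indicator {a..b} x *\<^sub>R g x) = 0" if ab: "\<alpha> < a" "b < \<beta>" for a b
  proof -
    have sub: "{a..b} \<subseteq> ?\<Omega>" using ab by auto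
    have int: "integrable (lebesgue_on ?\<Omega>) (\<lambda>x. indicator {a..b} x *\<^sub>R g x)"
      using setint[OF ab] sub
      by (simp add: integrable_restrict_space set_integrable_def indicator_inter_arith[symmetric] inf.absorb2)
    have meas: "(\<lambda>x. bump a b n x *\<^sub>R g x) \<in> borel_measurable (lebesgue_on ?\<Omega>)" for n
      using integrable_test_function(1)[OF test_function_bump[OF ab] g] by auto
    have "(\<lambda>n. LINT x|lebesgue_on ?\<Omega>. bump a b n x *\<^sub>R g x) \<longlonglongrightarrow>
        (LINT x|lebesgue_on ?\<Omega>. indicator {a<..<b} x *\<^sub>R g x)"
    proof (rule integral_dominated_convergence[where w = "\<lambda>x. norm (indicator {a..b} x *\<^sub>R g x)"])
      show "AE x in lebesgue_on ?\<Omega>. (\<lambda>n. bump a b n x *\<^sub>R g x) \<longlonglongrightarrow> indicator {a<..<b} x *\<^sub>R g x"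
        by (intro AE_I2 tendsto_scaleR bump_tendsto tendsto_const)
      show "AE x in lebesgue_on ?\<Omega>. norm (bump a b n x *\<^sub>R g x) \<le> norm (indicator {a..b} x *\<^sub>R g x)" for n
        using bump_bounds[of a b n]
        by (intro AE_I2) (auto simp: indicator_def bump_eq mult_left_le_one_le abs_mult mult_le_one)
      show "(\<lambda>x. indicator {a<..<b} x *\<^sub>R g x) \<in> borel_measurable (lebesgue_on ?\<Omega>)"
      proof (intro borel_measurable_scaleR borel_measurable_indicator locally_integrable_measurable[OF g])
        have "{a<..<b} \<subseteq> ?\<Omega>" using ab by auto
        then show "{a<..<b} \<in> sets (lebesgue_on ?\<Omega>)" by (simp add: sets_restrict_space_iff)
      qed
    qed (use integrable_norm[OF int] meas in auto)
    then have "(\<lambda>n. 0) \<longlonglongrightarrow> (LINT x|lebesgue_on ?\<Omega>. indicator {a<..<b} x *\<^sub>R g x)"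
      by (simp add: zero test_function_bump[OF ab])
    then have "(LINT x|lebesgue_on ?\<Omega>. indicator {a<..<b} x *\<^sub>R g x) = 0"
      using LIMSEQ_unique tendsto_const by blast
    moreover have "indicator ?\<Omega> x * indicator {a<..<b} x = (indicator {a<..<b} x :: real)" for x
      using ab by (auto simp: indicator_def)
    ultimately have "(LINT x|lebesgue. indicator {a<..<b} x *\<^sub>R g x) = 0"
      using integral_restrict_space[of ?\<Omega> lebesgue "\<lambda>x. indicator {a<..<b} x *\<^sub>R g x"] by simp
    moreover have "(LINT x|lebesgue. indicator {a..b} x *\<^sub>R g x) = (LINT x|lebesgue. indicator {a<..<b} x *\<^sub>R g x)"
    proof (rule integral_cong_AE)
      have "set_integrable lebesgue {a<..<b} g"
        by (rule set_integrable_subset[OF setint[OF ab]]) auto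
      then show "(\<lambda>x. indicator {a<..<b} x *\<^sub>R g x) \<in> borel_measurable lebesgue"
        by (auto simp: set_integrable_def)
      show "(\<lambda>x. indicator {a..b} x *\<^sub>R g x) \<in> borel_measurable lebesgue"
        using setint[OF ab] by (auto simp: set_integrable_def)
      have "AE x in lebesgue. x \<noteq> a" "AE x in lebesgue. x \<noteq> b"
        by (auto intro: AE_completion AE_lborel_singleton)
      then show "AE x in lebesgue. indicator {a..b} x *\<^sub>R g x = indicator {a<..<b} x *\<^sub>R g x"
        by eventually_elim (auto simp: indicator_def)
    qed
    ultimately show ?thesis by simp
  qed
  \<comment> \<open>\<open>g\<close> need not be integrable up to the boundary, so it is first cut off to compact subintervals
    exhausting \<open>\<Omega>\<close>.\<close>
  have "AE x in lebesgue. indicator {\<alpha> + 1 / real (Suc n)..\<beta> - 1 / real (Suc n)} x *\<^sub>R g x = 0" for n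
  proof (rule AE_zero_if_interval_integrals_zero)
    let ?c = "\<alpha> + 1 / real (Suc n)" and ?d = "\<beta> - 1 / real (Suc n)"
    have pos: "1 / real (Suc n) > 0" by simp
    then have cd: "\<alpha> < ?c" "?d < \<beta>" by linarith+
    show "integrable lebesgue (\<lambda>x. indicator {?c..?d} x *\<^sub>R g x)"
      using setint[OF cd] by (simp add: set_integrable_def)
    show "(LINT x|lebesgue. indicator {a..b} x *\<^sub>R indicator {?c..?d} x *\<^sub>R g x) = 0" for a b
    proof -
      have "indicator {a..b} x * indicator {?c..?d} x = (indicator {max a ?c..min b ?d} x :: real)" for x
        by (auto simp: indicator_def)
      then show ?thesis using interval[of "max a ?c" "min b ?d"] cd by (simp add: less_max_iff_disj min_less_iff_disj)
    qed
  qed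
  then have "AE x in lebesgue. \<forall>n. indicator {\<alpha> + 1 / real (Suc n)..\<beta> - 1 / real (Suc n)} x *\<^sub>R g x = 0"
    by (intro AE_all_countable[THEN iffD2] allI)
  then have "AE x in lebesgue. x \<in> ?\<Omega> \<longrightarrow> g x = 0"
  proof eventually_elim
    case (elim x)
    show ?case
    proof
      assume "x \<in> ?\<Omega>"
      then have "0 < min (x - \<alpha>) (\<beta> - x)" by simp
      then obtain n where "1 / real (Suc n) < min (x - \<alpha>) (\<beta> - x)"
        using nat_approx_posE by blast
      then show "g x = 0" using spec[OF elim, of n] by (simp add: indicator_def)
    qed
  qed
  then show ?thesis by (simp add: AE_restrict_space_iff)
qed

lemma is_weak_deriv_unique:
  assumes "is_weak_deriv {\<alpha><..<\<beta>} f g" "is_weak_deriv {\<alpha><..<\<beta>} f h"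
  shows "AE x in lebesgue_on {\<alpha><..<\<beta>}. g x = h x"
proof -
  let ?\<Omega> = "{\<alpha><..<\<beta>}"
  have w: "is_weak_deriv ?\<Omega> (\<lambda>x. f x + (-1) * f x) (\<lambda>x. g x + (-1) * h x)"
    by (intro is_weak_deriv_add is_weak_deriv_cmult assms) simp
  then have "AE x in lebesgue_on ?\<Omega>. g x + (-1) * h x = 0"
    by (intro fundamental_lemma) (auto simp: is_weak_deriv_def)
  then show ?thesis by eventually_elim simp
qed

lemma is_weak_deriv_cong_AE:
  assumes "f \<in> borel_measurable (lebesgue_on \<Omega>)" "g \<in> borel_measurable (lebesgue_on \<Omega>)"
    and ae: "AE x in lebesgue_on \<Omega>. f x = g x" and \<Omega>: "\<Omega> \<in> sets lebesgue"
    and w: "is_weak_deriv \<Omega> f h"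
  shows "is_weak_deriv \<Omega> g h"
proof -
  have "negligible {x \<in> \<Omega>. f x \<noteq> g x}"
  proof -
    have "AE x in lebesgue. \<not> (x \<in> \<Omega> \<and> f x \<noteq> g x)"
      using ae \<Omega> by (simp add: AE_restrict_space_iff)
    then show ?thesis
      by (simp add: negligible_iff_null_sets completion.AE_iff_null_sets)
  qed
  then have "locally_integrable \<Omega> g"
    using w by (auto simp: is_weak_deriv_def locally_integrable_def intro: absolutely_integrable_spike)
  moreover have "(LINT x|lebesgue_on \<Omega>. deriv \<phi> x *\<^sub>R g x) = (LINT x|lebesgue_on \<Omega>. deriv \<phi> x *\<^sub>R f x)"
    if \<phi>: "test_function \<Omega> \<phi>" for \<phi>
  proof (rule integral_cong_AE)
    show "AE x in lebesgue_on \<Omega>. deriv \<phi> x *\<^sub>R g x = deriv \<phi> x *\<^sub>R f x"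
      using ae by eventually_elim simp
  qed (use integrable_test_function(2)[OF \<phi> _ \<Omega>] calculation w in \<open>auto simp: is_weak_deriv_def\<close>)
  ultimately show ?thesis using w by (simp add: is_weak_deriv_def)
qed

section \<open>Orlicz and Musielak-Orlicz functions\<close>

lemma orlicz_scale:
  assumes "orlicz_function \<phi>" "0 \<le> c" "c \<le> 1" "0 \<le> t"
  shows "\<phi> (c * t) \<le> c * \<phi> t"
proof -
  have "convex_on {0..} \<phi>" "\<phi> 0 = 0" using assms(1) by (auto simp: orlicz_function_def)
  then show ?thesis using convex_onD[of "{0..}" \<phi> c 0 t] assms(2-4) by simp
qed

lemma orlicz_nonneg: "orlicz_function \<phi> \<Longrightarrow> 0 \<le> t \<Longrightarrow> 0 \<le> \<phi> t"
  by (simp add: orlicz_function_def)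

lemma orlicz_zero: "orlicz_function \<phi> \<Longrightarrow> \<phi> 0 = 0"
  by (simp add: orlicz_function_def)

lemma orlicz_mono:
  assumes "orlicz_function \<phi>" "0 \<le> s" "s \<le> t"
  shows "\<phi> s \<le> \<phi> t"
proof (cases "t = 0")
  case False
  then have "\<phi> ((s / t) * t) \<le> (s / t) * \<phi> t"
    using assms by (intro orlicz_scale) auto
  also have "\<dots> \<le> 1 * \<phi> t"
    using assms False by (intro mult_right_mono orlicz_nonneg[OF assms(1)]) auto
  finally show ?thesis using False by simp
qed (use assms in auto)

text \<open>Convexity forces at least linear growth beyond any point where \<open>\<phi>\<close> does not vanish.\<close>

lemma orlicz_ge_linear:
  assumes "orlicz_function \<phi>"
  obtains c b where "c > 0" "\<And>t. 0 \<le> t \<Longrightarrow> c * t - b \<le> \<phi> t"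
proof -
  obtain s where s: "s \<ge> 0" "\<phi> s \<noteq> 0" using assms by (auto simp: orlicz_function_def)
  then have "s > 0" "\<phi> s > 0"
    using orlicz_zero[OF assms] orlicz_nonneg[OF assms s(1)] by (auto simp: less_le)
  show thesis
  proof (rule that[of "\<phi> s / s" "\<phi> s"])
    show "0 < \<phi> s / s" using \<open>s > 0\<close> \<open>\<phi> s > 0\<close> by simp
    show "\<phi> s / s * t - \<phi> s \<le> \<phi> t" if "t \<ge> 0" for t
    proof (cases "s \<le> t")
      case True
      then have "\<phi> ((s / t) * t) \<le> (s / t) * \<phi> t"
        using assms \<open>s > 0\<close> by (intro orlicz_scale) auto
      then have "\<phi> s / s * t \<le> \<phi> t"
        using True \<open>s > 0\<close> by (simp add: field_simps)
      then show ?thesis using \<open>\<phi> s > 0\<close> by linarith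
    next
      case False
      then have "\<phi> s / s * t \<le> \<phi> s"
        using \<open>s > 0\<close> \<open>\<phi> s > 0\<close> by (simp add: field_simps)
      then show ?thesis using orlicz_nonneg[OF assms that] by linarith
    qed
  qed
qed

text \<open>A convex function is continuous in the interior of its domain; at \<open>0\<close> continuity is part of the
  definition.\<close>

lemma orlicz_continuous:
  assumes "orlicz_function \<phi>"
  shows "continuous_on {0..} \<phi>"
proof -
  have "convex_on {0<..} \<phi>"
    using assms by (auto simp: orlicz_function_def intro: convex_on_subset)
  then have pos: "continuous_on {0<..} \<phi>" by (intro convex_on_continuous) auto
  show ?thesis
    unfolding continuous_on_eq_continuous_within
  proof
    fix t :: real assume "t \<in> {0..}"
    show "continuous (at t within {0..}) \<phi>"
    proof (cases "t = 0")
      case True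
      then show ?thesis
        using assms by (auto simp: orlicz_function_def continuous_within at_within_Ici_at_right)
    next
      case False
      then have "isCont \<phi> t"
        using pos \<open>t \<in> {0..}\<close> by (auto simp: continuous_on_eq_continuous_at)
      then show ?thesis by (rule continuous_at_imp_continuous_at_within)
    qed
  qed
qed

lemma musielak_orlicz_AE: "musielak_orlicz \<Omega> \<Phi> \<Longrightarrow> AE x in lebesgue_on \<Omega>. orlicz_function (\<Phi> x)"
  by (simp add: musielak_orlicz_def)

lemma floor_approx_tendsto:
  assumes "0 \<le> (u::real)"
  shows "(\<lambda>n. real (nat \<lfloor>real n * u\<rfloor>) / real n) \<longlonglongrightarrow> u"
proof (rule tendsto_sandwich)
  have eq: "real (nat \<lfloor>real n * u\<rfloor>) = of_int \<lfloor>real n * u\<rfloor>" for n using assms by simp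
  show "\<forall>\<^sub>F n in sequentially. u - 1 / real n \<le> real (nat \<lfloor>real n * u\<rfloor>) / real n"
    using eventually_gt_at_top[of 0]
  proof eventually_elim
    case (elim n)
    have "real n * u - 1 \<le> of_int \<lfloor>real n * u\<rfloor>" by linarith
    then have "(real n * u - 1) / real n \<le> real (nat \<lfloor>real n * u\<rfloor>) / real n"
      unfolding eq by (rule divide_right_mono) simp
    then show ?case using elim by (simp add: diff_divide_distrib)
  qed
  show "\<forall>\<^sub>F n in sequentially. real (nat \<lfloor>real n * u\<rfloor>) / real n \<le> u"
    using eventually_gt_at_top[of 0]
  proof eventually_elim
    case (elim n)
    have "real (nat \<lfloor>real n * u\<rfloor>) / real n \<le> (real n * u) / real n"
      unfolding eq by (rule divide_right_mono) auto
    then show ?case using elim by simp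
  qed
  show "(\<lambda>n. u - 1 / real n) \<longlonglongrightarrow> u"
    using tendsto_diff[OF tendsto_const[of u] lim_1_over_n] by simp
qed simp

text \<open>Measurability of \<open>\<Phi>(\<cdot>, t)\<close> is only given for constant \<open>t\<close>. It passes to countably valued \<open>u\<close>,
  and then to arbitrary \<open>u\<close> by the approximations \<open>\<lfloor>n u\<rfloor> / n\<close> and continuity in the second
  argument.\<close>

lemma musielak_orlicz_measurable:
  fixes u :: "real \<Rightarrow> real"
  assumes MO: "musielak_orlicz \<Omega> \<Phi>" and \<Omega>: "\<Omega> \<in> sets lebesgue"
    and u[measurable]: "u \<in> borel_measurable (lebesgue_on \<Omega>)" and nonneg: "\<And>x. x \<in> \<Omega> \<Longrightarrow> 0 \<le> u x"
  shows "(\<lambda>x. \<Phi> x (u x)) \<in> borel_measurable (lebesgue_on \<Omega>)"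
proof -
  \<comment> \<open>The approximations need not converge off \<open>G\<close>; this set is measurable because Lebesgue measure is
    complete.\<close>
  define G where "G = {x \<in> \<Omega>. orlicz_function (\<Phi> x)}"
  have ae: "AE x in lebesgue. x \<in> \<Omega> \<longrightarrow> orlicz_function (\<Phi> x)"
    using musielak_orlicz_AE[OF MO] \<Omega> by (simp add: AE_restrict_space_iff)
  moreover have "{x \<in> space lebesgue. \<not> (x \<in> \<Omega> \<longrightarrow> orlicz_function (\<Phi> x))} = \<Omega> - G"
    by (auto simp: G_def)
  ultimately have "\<Omega> - G \<in> null_sets lebesgue"
    unfolding completion.AE_iff_null_sets by simp
  then have "\<Omega> - (\<Omega> - G) \<in> sets lebesgue" using \<Omega> by auto
  moreover have "\<Omega> - (\<Omega> - G) = G" by (auto simp: G_def)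
  ultimately have G: "G \<in> sets (lebesgue_on \<Omega>)"
    by (auto simp: sets_restrict_space_iff \<Omega> G_def)
  have w: "(\<lambda>x. \<Phi> x (real (nat \<lfloor>real n * u x\<rfloor>) / real n)) \<in> borel_measurable (lebesgue_on \<Omega>)" for n
  proof (rule measurable_compose_countable'[where f = "\<lambda>k x. \<Phi> x (real k / real n)" and I = UNIV
        and g = "\<lambda>x. nat \<lfloor>real n * u x\<rfloor>"])
    show "(\<lambda>x. \<Phi> x (real k / real n)) \<in> borel_measurable (lebesgue_on \<Omega>)" for k
      using MO by (simp add: musielak_orlicz_def)
  qed auto
  have "(\<lambda>x. if x \<in> G then \<Phi> x (u x) else 0) \<in> borel_measurable (lebesgue_on \<Omega>)"
  proof (rule borel_measurable_LIMSEQ_metric)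
    fix x assume x: "x \<in> space (lebesgue_on \<Omega>)"
    show "(\<lambda>n. if x \<in> G then \<Phi> x (real (nat \<lfloor>real n * u x\<rfloor>) / real n) else 0) \<longlonglongrightarrow> (if x \<in> G then \<Phi> x (u x) else 0)"
    proof (cases "x \<in> G")
      case True
      have "u x \<ge> 0" using x nonneg by simp
      have "continuous_on {0..} (\<Phi> x)" using True orlicz_continuous by (simp add: G_def)
      then have "(\<lambda>n. \<Phi> x (real (nat \<lfloor>real n * u x\<rfloor>) / real n)) \<longlonglongrightarrow> \<Phi> x (u x)"
        by (rule continuous_on_tendsto_compose[OF _ floor_approx_tendsto]) (use \<open>u x \<ge> 0\<close> in auto)
      then show ?thesis using True by simp
    qed simp
  next
    show "(\<lambda>x. if x \<in> G then \<Phi> x (real (nat \<lfloor>real n * u x\<rfloor>) / real n) else 0) \<in> borel_measurable (lebesgue_on \<Omega>)" for n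
      by (rule measurable_If_set[OF w measurable_const]) (use G in \<open>simp_all add: sets.Int_space_eq2[OF G, simplified]\<close>)
  qed
  then have "(\<lambda>x. if x \<in> \<Omega> then if x \<in> G then \<Phi> x (u x) else 0 else 0) \<in> borel_measurable lebesgue"
    by (rule borel_measurable_if_I[OF _ \<Omega>])
  moreover have "AE x in lebesgue. (if x \<in> \<Omega> then if x \<in> G then \<Phi> x (u x) else 0 else 0) = (if x \<in> \<Omega> then \<Phi> x (u x) else 0)"
    using ae by eventually_elim (auto simp: G_def)
  ultimately have "(\<lambda>x. if x \<in> \<Omega> then \<Phi> x (u x) else 0) \<in> borel_measurable lebesgue"
    by (rule borel_measurable_AE)
  then show ?thesis by (rule borel_measurable_if_D)
qed

section \<open>The modular and the Luxemburg norm\<close>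

lemma modular_integrand_measurable:
  assumes "musielak_orlicz \<Omega> \<Phi>" "\<Omega> \<in> sets lebesgue" "f \<in> borel_measurable (lebesgue_on \<Omega>)"
  shows "(\<lambda>x. ennreal (\<Phi> x (cmod (f x)))) \<in> borel_measurable (lebesgue_on \<Omega>)"
proof -
  have "(\<lambda>x. \<Phi> x (cmod (f x))) \<in> borel_measurable (lebesgue_on \<Omega>)"
    using assms(3) by (intro musielak_orlicz_measurable[OF assms(1,2)]) auto
  then show ?thesis by simp
qed

lemma modular_mono:
  assumes "musielak_orlicz \<Omega> \<Phi>" "AE x in lebesgue_on \<Omega>. cmod (f x) \<le> cmod (g x)"
  shows "modular \<Omega> \<Phi> f \<le> modular \<Omega> \<Phi> g"
  unfolding modular_def
proof (rule nn_integral_mono_AE)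
  show "AE x in lebesgue_on \<Omega>. ennreal (\<Phi> x (cmod (f x))) \<le> ennreal (\<Phi> x (cmod (g x)))"
    using musielak_orlicz_AE[OF assms(1)] assms(2)
  proof eventually_elim
    case (elim x)
    show ?case by (intro ennreal_leI orlicz_mono[OF elim(1)] norm_ge_zero elim(2))
  qed
qed

lemma luxemburg_norm_le:
  assumes "l > 0" "modular \<Omega> \<Phi> (\<lambda>x. f x / complex_of_real l) \<le> 1"
  shows "luxemburg_norm \<Omega> \<Phi> f \<le> ennreal l"
  unfolding luxemburg_norm_def by (rule Inf_lower) (use assms in auto)

text \<open>The infimum defining the norm is over a set that is closed upwards, since the modular decreases
  when the argument is divided by a larger number.\<close>

lemma modular_le_one_if_luxemburg_less:
  assumes "musielak_orlicz \<Omega> \<Phi>" "luxemburg_norm \<Omega> \<Phi> f < ennreal r"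
  shows "modular \<Omega> \<Phi> (\<lambda>x. f x / complex_of_real r) \<le> 1"
proof -
  obtain l where l: "l > 0" "modular \<Omega> \<Phi> (\<lambda>x. f x / complex_of_real l) \<le> 1" "ennreal l < ennreal r"
    using assms(2) by (auto simp: luxemburg_norm_def Inf_less_iff)
  then have "l < r" by (metis ennreal_leI leD leI)
  have "modular \<Omega> \<Phi> (\<lambda>x. f x / complex_of_real r) \<le> modular \<Omega> \<Phi> (\<lambda>x. f x / complex_of_real l)"
    using \<open>l > 0\<close> \<open>l < r\<close>
    by (intro modular_mono[OF assms(1)] AE_I2) (simp add: norm_divide divide_left_mono)
  then show ?thesis using l(2) by simp
qed

text \<open>Covers both passage to an almost everywhere equal function and multiplication by scalars of
  modulus one.\<close>

lemma luxemburg_norm_cong_cmod: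
  assumes "AE x in lebesgue_on \<Omega>. cmod (f x) = cmod (g x)"
  shows "luxemburg_norm \<Omega> \<Phi> f = luxemburg_norm \<Omega> \<Phi> g"
proof -
  have "modular \<Omega> \<Phi> (\<lambda>x. f x / complex_of_real l) = modular \<Omega> \<Phi> (\<lambda>x. g x / complex_of_real l)" for l
    unfolding modular_def
  proof (rule nn_integral_cong_AE)
    show "AE x in lebesgue_on \<Omega>. ennreal (\<Phi> x (cmod (f x / complex_of_real l))) = ennreal (\<Phi> x (cmod (g x / complex_of_real l)))"
      using assms by eventually_elim (simp add: norm_divide)
  qed
  then show ?thesis by (simp add: luxemburg_norm_def)
qed

lemma modular_convex:
  assumes MO: "musielak_orlicz \<Omega> \<Phi>" and \<Omega>: "\<Omega> \<in> sets lebesgue"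
    and f: "f \<in> borel_measurable (lebesgue_on \<Omega>)" and g: "g \<in> borel_measurable (lebesgue_on \<Omega>)"
    and \<theta>: "0 \<le> \<theta>" "\<theta> \<le> 1"
  shows "modular \<Omega> \<Phi> (\<lambda>x. complex_of_real (1 - \<theta>) * f x + complex_of_real \<theta> * g x) \<le> ennreal (1 - \<theta>) * modular \<Omega> \<Phi> f + ennreal \<theta> * modular \<Omega> \<Phi> g"
proof -
  have "modular \<Omega> \<Phi> (\<lambda>x. complex_of_real (1 - \<theta>) * f x + complex_of_real \<theta> * g x) \<le>
    (\<integral>\<^sup>+x. ennreal (1 - \<theta>) * ennreal (\<Phi> x (cmod (f x))) + ennreal \<theta> * ennreal (\<Phi> x (cmod (g x))) \<partial>lebesgue_on \<Omega>)"
    unfolding modular_def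
  proof (rule nn_integral_mono_AE)
    show "AE x in lebesgue_on \<Omega>. ennreal (\<Phi> x (cmod (complex_of_real (1 - \<theta>) * f x + complex_of_real \<theta> * g x)))
        \<le> ennreal (1 - \<theta>) * ennreal (\<Phi> x (cmod (f x))) + ennreal \<theta> * ennreal (\<Phi> x (cmod (g x)))"
      using musielak_orlicz_AE[OF MO]
    proof eventually_elim
      case (elim x)
      have "cmod (complex_of_real (1 - \<theta>) * f x + complex_of_real \<theta> * g x) \<le> cmod (complex_of_real (1 - \<theta>) * f x) + cmod (complex_of_real \<theta> * g x)"
        by (rule norm_triangle_ineq)
      also have "\<dots> = (1 - \<theta>) * cmod (f x) + \<theta> * cmod (g x)"
        using \<theta> by (simp add: norm_mult del: of_real_diff)
      finally have "\<Phi> x (cmod (complex_of_real (1 - \<theta>) * f x + complex_of_real \<theta> * g x)) \<le> \<Phi> x ((1 - \<theta>) * cmod (f x) + \<theta> * cmod (g x))"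
        by (intro orlicz_mono[OF elim]) auto
      also have "\<dots> \<le> (1 - \<theta>) * \<Phi> x (cmod (f x)) + \<theta> * \<Phi> x (cmod (g x))"
        using elim \<theta> convex_onD[of "{0..}" "\<Phi> x" \<theta> "cmod (f x)" "cmod (g x)"]
        by (simp add: orlicz_function_def)
      finally have "ennreal (\<Phi> x (cmod (complex_of_real (1 - \<theta>) * f x + complex_of_real \<theta> * g x)))
          \<le> ennreal ((1 - \<theta>) * \<Phi> x (cmod (f x)) + \<theta> * \<Phi> x (cmod (g x)))"
        by (rule ennreal_leI)
      also have "\<dots> = ennreal (1 - \<theta>) * ennreal (\<Phi> x (cmod (f x))) + ennreal \<theta> * ennreal (\<Phi> x (cmod (g x)))"
      proof -
        have "0 \<le> \<Phi> x (cmod (f x))" "0 \<le> \<Phi> x (cmod (g x))"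
          using orlicz_nonneg[OF elim] by simp_all
        then show ?thesis
          using \<theta>(1,2) by (subst ennreal_plus) (simp_all add: ennreal_mult)
      qed
      finally show ?case .
    qed
  qed
  also have "\<dots> = ennreal (1 - \<theta>) * modular \<Omega> \<Phi> f + ennreal \<theta> * modular \<Omega> \<Phi> g"
    unfolding modular_def
    using modular_integrand_measurable[OF MO \<Omega> f] modular_integrand_measurable[OF MO \<Omega> g]
    by (simp add: nn_integral_add nn_integral_cmult)
  finally show ?thesis .
qed

lemma luxemburg_norm_triangle:
  assumes MO: "musielak_orlicz \<Omega> \<Phi>" and \<Omega>: "\<Omega> \<in> sets lebesgue"
    and f: "f \<in> borel_measurable (lebesgue_on \<Omega>)" and g: "g \<in> borel_measurable (lebesgue_on \<Omega>)"
  shows "luxemburg_norm \<Omega> \<Phi> (\<lambda>x. f x + g x) \<le> luxemburg_norm \<Omega> \<Phi> f + luxemburg_norm \<Omega> \<Phi> g"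
proof (rule ennreal_le_epsilon)
  fix e :: real
  assume e: "0 < e" and "luxemburg_norm \<Omega> \<Phi> f + luxemburg_norm \<Omega> \<Phi> g < top"
  then obtain p q where p: "luxemburg_norm \<Omega> \<Phi> f = ennreal p" "0 \<le> p"
    and q: "luxemburg_norm \<Omega> \<Phi> g = ennreal q" "0 \<le> q"
    by (cases "luxemburg_norm \<Omega> \<Phi> f"; cases "luxemburg_norm \<Omega> \<Phi> g") auto
  \<comment> \<open>With \<open>a\<close>, \<open>b\<close> just above the two norms, \<open>(f + g) / (a + b)\<close> is a convex combination of \<open>f / a\<close>
    and \<open>g / b\<close>, both of modular at most one.\<close>
  define a b where "a = p + e / 2" and "b = q + e / 2"
  have ab: "a > 0" "b > 0" using p q e by (auto simp: a_def b_def)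
  define \<theta> where "\<theta> = b / (a + b)"
  have \<theta>: "0 \<le> \<theta>" "\<theta> \<le> 1" "1 - \<theta> = a / (a + b)"
    using ab by (auto simp: \<theta>_def field_simps)
  let ?F = "\<lambda>x. f x / complex_of_real a" and ?G = "\<lambda>x. g x / complex_of_real b"
  have "(f x + g x) / complex_of_real (a + b) = complex_of_real (1 - \<theta>) * ?F x + complex_of_real \<theta> * ?G x" for x
  proof -
    have "complex_of_real (1 - \<theta>) * ?F x = f x / complex_of_real (a + b)"
      unfolding \<theta>(3) using ab by (simp add: field_simps)
    moreover have "complex_of_real \<theta> * ?G x = g x / complex_of_real (a + b)"
      unfolding \<theta>_def using ab by (simp add: field_simps)
    ultimately show ?thesis by (simp add: add_divide_distrib)
  qed
  then have "modular \<Omega> \<Phi> (\<lambda>x. (f x + g x) / complex_of_real (a + b))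
      = modular \<Omega> \<Phi> (\<lambda>x. complex_of_real (1 - \<theta>) * ?F x + complex_of_real \<theta> * ?G x)" by simp
  also have "\<dots> \<le> ennreal (1 - \<theta>) * modular \<Omega> \<Phi> ?F + ennreal \<theta> * modular \<Omega> \<Phi> ?G"
    by (rule modular_convex[OF MO \<Omega> _ _ \<theta>(1,2)]) (use f g in auto)
  also have "\<dots> \<le> ennreal (1 - \<theta>) * 1 + ennreal \<theta> * 1"
    by (intro add_mono mult_left_mono modular_le_one_if_luxemburg_less[OF MO])
      (use p q e in \<open>auto simp: a_def b_def ennreal_less_iff\<close>)
  also have "\<dots> = 1" using \<theta>(1,2) by (simp flip: ennreal_plus)
  finally have "luxemburg_norm \<Omega> \<Phi> (\<lambda>x. f x + g x) \<le> ennreal (a + b)"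
    using ab by (intro luxemburg_norm_le) auto
  also have "\<dots> = luxemburg_norm \<Omega> \<Phi> f + luxemburg_norm \<Omega> \<Phi> g + ennreal e"
    using p q e by (simp add: a_def b_def flip: ennreal_plus)
  finally show "luxemburg_norm \<Omega> \<Phi> (\<lambda>x. f x + g x) \<le> luxemburg_norm \<Omega> \<Phi> f + luxemburg_norm \<Omega> \<Phi> g + ennreal e" .
qed

lemma luxemburg_norm_zero:
  assumes "musielak_orlicz \<Omega> \<Phi>" "AE x in lebesgue_on \<Omega>. f x = 0"
  shows "luxemburg_norm \<Omega> \<Phi> f = 0"
proof -
  have "luxemburg_norm \<Omega> \<Phi> f \<le> 0 + ennreal e" if "0 < e" for e
  proof -
    have "AE x in lebesgue_on \<Omega>. ennreal (\<Phi> x (cmod (f x / complex_of_real e))) = 0"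
      using musielak_orlicz_AE[OF assms(1)] assms(2)
      by eventually_elim (simp add: orlicz_zero)
    then have "modular \<Omega> \<Phi> (\<lambda>x. f x / complex_of_real e) = (\<integral>\<^sup>+x. 0 \<partial>lebesgue_on \<Omega>)"
      unfolding modular_def by (rule nn_integral_cong_AE)
    then show ?thesis using luxemburg_norm_le[OF that, of \<Omega> \<Phi> f] by simp
  qed
  then have "luxemburg_norm \<Omega> \<Phi> f \<le> 0" by (rule ennreal_le_epsilon) auto
  then show ?thesis by simp
qed

text \<open>If the norm vanishes, every multiple of \<open>f\<close> has modular at most \<open>1\<close>. By convexity the modular grows
  at least linearly along multiples, so all these modulars are \<open>0\<close>. Hence \<open>\<Phi>(x, m \<bar>f(x)\<bar>) = 0\<close> for all
  \<open>m\<close> almost everywhere, which contradicts the growth of \<open>\<Phi>(x, \<cdot>)\<close> unless \<open>f(x) = 0\<close>.\<close>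

lemma luxemburg_norm_eq_zero_imp:
  assumes MO: "musielak_orlicz \<Omega> \<Phi>" and \<Omega>: "\<Omega> \<in> sets lebesgue"
    and f: "f \<in> borel_measurable (lebesgue_on \<Omega>)" and zero: "luxemburg_norm \<Omega> \<Phi> f = 0"
  shows "AE x in lebesgue_on \<Omega>. f x = 0"
proof -
  have "modular \<Omega> \<Phi> (\<lambda>x. f x / complex_of_real r) = 0" if "r > 0" for r
  proof -
    let ?I = "modular \<Omega> \<Phi> (\<lambda>x. f x / complex_of_real r)"
    have le: "of_nat (Suc n) * ?I \<le> 1" for n
    proof -
      let ?s = "r / real (Suc n)"
      have "of_nat (Suc n) * ?I = (\<integral>\<^sup>+x. ennreal (real (Suc n)) * ennreal (\<Phi> x (cmod (f x / complex_of_real r))) \<partial>lebesgue_on \<Omega>)"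
        unfolding modular_def ennreal_of_nat_eq_real_of_nat
        by (intro nn_integral_cmult[symmetric] modular_integrand_measurable[OF MO \<Omega>]) (use f in auto)
      also have "\<dots> \<le> modular \<Omega> \<Phi> (\<lambda>x. f x / complex_of_real ?s)"
        unfolding modular_def
      proof (rule nn_integral_mono_AE)
        show "AE x in lebesgue_on \<Omega>. ennreal (real (Suc n)) * ennreal (\<Phi> x (cmod (f x / complex_of_real r)))
            \<le> ennreal (\<Phi> x (cmod (f x / complex_of_real ?s)))"
          using musielak_orlicz_AE[OF MO]
        proof eventually_elim
          case (elim x)
          let ?t = "cmod (f x / complex_of_real ?s)"
          have eq: "1 / real (Suc n) * ?t = cmod (f x / complex_of_real r)"
            using that by (simp add: norm_divide norm_mult del: of_nat_Suc)
          have "\<Phi> x (1 / real (Suc n) * ?t) \<le> 1 / real (Suc n) * \<Phi> x ?t"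
            by (rule orlicz_scale[OF elim]) auto
          then have "real (Suc n) * \<Phi> x (cmod (f x / complex_of_real r)) \<le> \<Phi> x ?t"
            unfolding eq by (simp add: field_simps)
          then have "ennreal (real (Suc n) * \<Phi> x (cmod (f x / complex_of_real r))) \<le> ennreal (\<Phi> x ?t)"
            by (rule ennreal_leI)
          moreover have "0 \<le> \<Phi> x (cmod (f x / complex_of_real r))"
            using orlicz_nonneg[OF elim] by simp
          ultimately show ?case by (simp only: ennreal_mult of_nat_0_le_iff)
        qed
      qed
      also have "\<dots> \<le> 1"
        using that by (intro modular_le_one_if_luxemburg_less[OF MO]) (simp add: zero)
      finally show ?thesis .
    qed
    show ?thesis
    proof (rule ccontr)
      assume "?I \<noteq> 0"
      moreover have "?I \<noteq> \<infinity>" using le[of 0] by (auto simp: top_unique)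
      ultimately obtain c where c: "?I = ennreal c" "c > 0"
        by (cases ?I) (auto simp: ennreal_eq_0_iff)
      obtain n where "1 / c < real n" using reals_Archimedean2 by blast
      then have "1 < real (Suc n) * c" using c(2) by (simp add: field_simps)
      moreover have "ennreal (real (Suc n) * c) \<le> 1"
        using le[of n] c by (simp add: ennreal_mult ennreal_of_nat_eq_real_of_nat)
      ultimately show False using c(2) by (simp add: ennreal_le_1)
    qed
  qed
  then have zero': "modular \<Omega> \<Phi> (\<lambda>x. f x / complex_of_real r) = 0" if "r > 0" for r
    using that by blast
  have "AE x in lebesgue_on \<Omega>. \<Phi> x (real (Suc n) * cmod (f x)) \<le> 0" for n
  proof -
    let ?g = "\<lambda>x. f x / complex_of_real (1 / real (Suc n))"
    have "AE x in lebesgue_on \<Omega>. ennreal (\<Phi> x (cmod (?g x))) = 0"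
      using zero'[of "1 / real (Suc n)"] nn_integral_0_iff_AE[OF modular_integrand_measurable[OF MO \<Omega>, of ?g]] f
      by (simp add: modular_def)
    then show ?thesis
      by eventually_elim (simp add: ennreal_eq_0_iff norm_divide norm_mult mult.commute del: of_nat_Suc)
  qed
  then have "AE x in lebesgue_on \<Omega>. \<forall>n. \<Phi> x (real (Suc n) * cmod (f x)) \<le> 0"
    by (intro AE_all_countable[THEN iffD2] allI)
  then show ?thesis
    using musielak_orlicz_AE[OF MO]
  proof eventually_elim
    case (elim x)
    obtain c b where c: "c > 0" "\<And>t. 0 \<le> t \<Longrightarrow> c * t - b \<le> \<Phi> x t"
      using orlicz_ge_linear[OF elim(2)] by blast
    show ?case
    proof (rule ccontr)
      assume "f x \<noteq> 0"
      then have pos: "0 < c * cmod (f x)" using c(1) by simp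
      obtain n where "b / (c * cmod (f x)) < real n" using reals_Archimedean2 by blast
      then have "b < real n * (c * cmod (f x))" using pos by (simp add: pos_divide_less_eq)
      also have "\<dots> \<le> real (Suc n) * (c * cmod (f x))" using pos by (intro mult_right_mono) auto
      finally have "0 < c * (real (Suc n) * cmod (f x)) - b" by (simp add: mult.left_commute)
      also have "\<dots> \<le> \<Phi> x (real (Suc n) * cmod (f x))" by (intro c(2)) simp
      also have "\<dots> \<le> 0" using elim(1) by blast
      finally show False by simp
    qed
  qed
qed

section \<open>Averages over signs\<close>

text \<open>A choice of signs is encoded by the set of indices that carry the sign \<open>+\<close>, so that averaging over
  all choices is a sum over a power set.\<close>

definition sign_sum :: "(nat \<Rightarrow> 'a::real_vector) \<Rightarrow> nat \<Rightarrow> nat set \<Rightarrow> 'a" where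
  "sign_sum a n A = (\<Sum>i<n. if i \<in> A then a i else - a i)"

definition sign_mean :: "nat \<Rightarrow> (nat set \<Rightarrow> real) \<Rightarrow> real" where
  "sign_mean n F = (\<Sum>A\<in>Pow {..<n}. F A) / 2 ^ n"

lemma sign_sum_Suc:
  assumes "A \<subseteq> {..<n}"
  shows "sign_sum a (Suc n) A = sign_sum a n A - a n"
    and "sign_sum a (Suc n) (insert n A) = sign_sum a n A + a n"
proof -
  have "n \<notin> A" using assms by auto
  then show "sign_sum a (Suc n) A = sign_sum a n A - a n"
    by (simp add: sign_sum_def)
  have "(\<Sum>i<n. if i \<in> insert n A then a i else - a i) = sign_sum a n A"
    unfolding sign_sum_def by (rule sum.cong) auto
  then show "sign_sum a (Suc n) (insert n A) = sign_sum a n A + a n"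
    by (simp add: sign_sum_def)
qed

text \<open>Averaging over the last sign first; this is the induction step for all moments.\<close>

lemma sign_mean_Suc:
  "sign_mean (Suc n) (\<lambda>A. F (sign_sum a (Suc n) A)) =
   sign_mean n (\<lambda>A. (F (sign_sum a n A + a n) + F (sign_sum a n A - a n)) / 2)"
proof -
  have disj: "Pow {..<n} \<inter> insert n ` Pow {..<n} = {}" by auto
  have inj: "inj_on (insert n) (Pow {..<n})" by (rule inj_onI) (metis (no_types) PowD insert_ident lessThan_iff less_irrefl subsetD)
  have "(\<Sum>A\<in>Pow {..<Suc n}. F (sign_sum a (Suc n) A)) =
      (\<Sum>A\<in>Pow {..<n}. F (sign_sum a (Suc n) A)) + (\<Sum>A\<in>insert n ` Pow {..<n}. F (sign_sum a (Suc n) A))"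
    by (simp add: lessThan_Suc Pow_insert sum.union_disjoint[OF _ _ disj])
  also have "(\<Sum>A\<in>insert n ` Pow {..<n}. F (sign_sum a (Suc n) A)) = (\<Sum>A\<in>Pow {..<n}. F (sign_sum a n A + a n))"
    by (simp add: sum.reindex[OF inj] sign_sum_Suc)
  finally show ?thesis
    by (simp add: sign_mean_def sign_sum_Suc sum.distrib sum_divide_distrib[symmetric])
qed

lemma sign_mean_add: "sign_mean n (\<lambda>A. F A + G A) = sign_mean n F + sign_mean n G"
  by (simp add: sign_mean_def sum.distrib add_divide_distrib)

lemma sign_mean_cmult: "sign_mean n (\<lambda>A. c * F A) = c * sign_mean n F"
  by (simp add: sign_mean_def sum_distrib_left)

lemma sign_mean_const: "sign_mean n (\<lambda>A. c) = c"
  by (simp add: sign_mean_def card_Pow)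

lemma sign_mean_mono: "(\<And>A. A \<subseteq> {..<n} \<Longrightarrow> F A \<le> G A) \<Longrightarrow> sign_mean n F \<le> sign_mean n G"
  unfolding sign_mean_def by (intro divide_right_mono sum_mono) auto

lemma sign_mean_norm_square:
  fixes a :: "nat \<Rightarrow> 'a::real_inner"
  shows "sign_mean n (\<lambda>A. norm (sign_sum a n A) ^ 2) = (\<Sum>i<n. norm (a i) ^ 2)"
proof (induction n)
  case 0
  show ?case by (simp add: sign_mean_def sign_sum_def)
next
  case (Suc n)
  have "(norm (s + b) ^ 2 + norm (s - b) ^ 2) / 2 = norm s ^ 2 + norm b ^ 2" for s b :: 'a
    by (simp add: power2_norm_eq_inner algebra_simps inner_commute)
  then have "sign_mean (Suc n) (\<lambda>A. norm (sign_sum a (Suc n) A) ^ 2) =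
      sign_mean n (\<lambda>A. norm (sign_sum a n A) ^ 2 + norm (a n) ^ 2)"
    by (simp only: sign_mean_Suc[of n "\<lambda>z. norm z ^ 2" a])
  then show ?case using Suc.IH by (simp add: sign_mean_add sign_mean_const)
qed

lemma sign_mean_norm_fourth:
  fixes a :: "nat \<Rightarrow> 'a::real_inner"
  shows "sign_mean n (\<lambda>A. norm (sign_sum a n A) ^ 4) \<le> 3 * (\<Sum>i<n. norm (a i) ^ 2) ^ 2"
proof (induction n)
  case 0
  show ?case by (simp add: sign_mean_def sign_sum_def)
next
  case (Suc n)
  let ?q = "\<Sum>i<n. norm (a i) ^ 2"
  have *: "(norm (s + b) ^ 4 + norm (s - b) ^ 4) / 2 \<le> norm s ^ 4 + (6 * norm b ^ 2) * norm s ^ 2 + norm b ^ 4"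
    for s b :: 'a
  proof -
    have 4: "norm z ^ 4 = (norm z ^ 2) ^ 2" for z :: 'a by simp
    have p: "norm (s + b) ^ 2 = norm s ^ 2 + norm b ^ 2 + 2 * (s \<bullet> b)"
      and m: "norm (s - b) ^ 2 = norm s ^ 2 + norm b ^ 2 - 2 * (s \<bullet> b)"
      by (simp_all add: power2_norm_eq_inner algebra_simps inner_commute)
    have "(s \<bullet> b) ^ 2 \<le> norm s ^ 2 * norm b ^ 2"
      using Cauchy_Schwarz_ineq[of s b] by (simp add: power2_norm_eq_inner)
    then show ?thesis
      unfolding 4 p m by (simp add: power2_eq_square algebra_simps)
  qed
  have "sign_mean (Suc n) (\<lambda>A. norm (sign_sum a (Suc n) A) ^ 4) \<le>
      sign_mean n (\<lambda>A. norm (sign_sum a n A) ^ 4 + (6 * norm (a n) ^ 2) * norm (sign_sum a n A) ^ 2 + norm (a n) ^ 4)"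
    using sign_mean_Suc[of n "\<lambda>z. norm z ^ 4" a] * by (simp add: sign_mean_mono)
  also have "\<dots> = sign_mean n (\<lambda>A. norm (sign_sum a n A) ^ 4) + (6 * norm (a n) ^ 2) * ?q + norm (a n) ^ 4"
    by (simp only: sign_mean_add sign_mean_cmult sign_mean_const sign_mean_norm_square)
  also have "\<dots> \<le> 3 * ?q ^ 2 + (6 * norm (a n) ^ 2) * ?q + 3 * norm (a n) ^ 4"
    using Suc.IH by (simp add: add_increasing)
  also have "\<dots> = 3 * (\<Sum>i<Suc n. norm (a i) ^ 2) ^ 2"
    by (simp add: power2_eq_square power4_eq_xxxx algebra_simps)
  finally show ?case .
qed

text \<open>Khinchine's inequality between first and second moments. The second moment is the sum of squares
  and the fourth is at most three times its square. An elementary inequality bounding \<open>s\<close> from below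
  by a combination of \<open>s\<^sup>2\<close> and \<open>s\<^sup>4\<close> transfers this to the first moment. The constant \<open>1/2\<close> is not
  optimal.\<close>

lemma khinchine:
  fixes a :: "nat \<Rightarrow> 'a::real_inner"
  shows "sqrt (\<Sum>i<n. norm (a i) ^ 2) / 2 \<le> sign_mean n (\<lambda>A. norm (sign_sum a n A))"
proof -
  define \<sigma> where "\<sigma> = sqrt (\<Sum>i<n. norm (a i) ^ 2)"
  have \<sigma>2: "\<sigma> ^ 2 = (\<Sum>i<n. norm (a i) ^ 2)" by (simp add: \<sigma>_def sum_nonneg)
  have "\<sigma> \<ge> 0" by (simp add: \<sigma>_def sum_nonneg)
  show ?thesis
  proof (cases "\<sigma> = 0")
    case True
    then show ?thesis
      using sign_mean_mono[of n "\<lambda>A. 0" "\<lambda>A. norm (sign_sum a n A)"]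
      by (simp add: sign_mean_const flip: \<sigma>_def)
  next
    case False
    \<comment> \<open>For \<open>u = s / l \<ge> 0\<close> the polynomial \<open>u (u - 1)\<^sup>2 (u + 2)\<close> is nonnegative, so
      \<open>2 u \<ge> 3 u\<^sup>2 - u\<^sup>4\<close>. The best scale is \<open>l = sqrt 3 * \<sigma>\<close>; the choice \<open>2 * \<sigma>\<close> still yields the factor
      \<open>9/16 \<ge> 1/2\<close>.\<close>
    define l where "l = 2 * \<sigma>"
    have l: "l > 0" using False \<open>\<sigma> \<ge> 0\<close> by (simp add: l_def)
    have *: "3 / (2 * l) * s ^ 2 + - 1 / (2 * l ^ 3) * s ^ 4 \<le> s" if "s \<ge> 0" for s
    proof -
      define u where "u = s / l"
      have "u \<ge> 0" using that l by (simp add: u_def)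
      then have "0 \<le> u * (u - 1) ^ 2 * (u + 2)" by simp
      then have "3 * u ^ 2 - u ^ 4 \<le> 2 * u" by (simp add: power2_eq_square power4_eq_xxxx algebra_simps)
      then have "l * (3 * u ^ 2 - u ^ 4) \<le> l * (2 * u)" using l by (intro mult_left_mono) auto
      moreover have "l * (2 * u) = 2 * s" "l * (3 * u ^ 2 - u ^ 4) = 2 * (3 / (2 * l) * s ^ 2 + - 1 / (2 * l ^ 3) * s ^ 4)"
        using l by (simp_all add: u_def field_simps power2_eq_square power3_eq_cube power4_eq_xxxx)
      ultimately show ?thesis by simp
    qed
    have "sign_mean n (\<lambda>A. norm (sign_sum a n A) ^ 4) \<le> 3 * \<sigma> ^ 4"
      using sign_mean_norm_fourth[of n a] by (simp flip: \<sigma>2)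
    then have "1 / (2 * l ^ 3) * sign_mean n (\<lambda>A. norm (sign_sum a n A) ^ 4) \<le> 1 / (2 * l ^ 3) * (3 * \<sigma> ^ 4)"
      using l by (intro mult_left_mono) auto
    moreover have "3 / (2 * l) * \<sigma> ^ 2 - 1 / (2 * l ^ 3) * (3 * \<sigma> ^ 4) = 9 / 16 * \<sigma>"
      using False by (simp add: l_def field_simps power2_eq_square power3_eq_cube power4_eq_xxxx)
    ultimately have "9 / 16 * \<sigma> \<le> sign_mean n (\<lambda>A. 3 / (2 * l) * norm (sign_sum a n A) ^ 2
         + - 1 / (2 * l ^ 3) * norm (sign_sum a n A) ^ 4)"
      unfolding sign_mean_add sign_mean_cmult sign_mean_norm_square \<sigma>2[symmetric] by linarith
    also have "\<dots> \<le> sign_mean n (\<lambda>A. norm (sign_sum a n A))"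
      by (intro sign_mean_mono *) simp
    finally show ?thesis using \<open>\<sigma> \<ge> 0\<close> by (simp flip: \<sigma>_def)
  qed
qed

lemma convex_sign_mean:
  fixes \<phi> :: "real \<Rightarrow> real"
  assumes "convex_on C \<phi>" "\<And>A. A \<subseteq> {..<n} \<Longrightarrow> F A \<in> C"
  shows "\<phi> (sign_mean n F) \<le> sign_mean n (\<lambda>A. \<phi> (F A))"
proof -
  have "\<phi> (\<Sum>A\<in>Pow {..<n}. (1 / 2 ^ n) *\<^sub>R F A) \<le> (\<Sum>A\<in>Pow {..<n}. 1 / 2 ^ n * \<phi> (F A))"
    by (rule convex_on_sum[OF _ _ assms(1)]) (use assms(2) in \<open>auto simp: card_Pow\<close>)
  then show ?thesis by (simp add: sign_mean_def sum_divide_distrib)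
qed

section \<open>Sequences with bounded signed sums under the doubling condition\<close>

lemma delta2_iterate:
  assumes "delta2 \<Omega> \<Phi>"
  shows "\<exists>C g. 0 \<le> C \<and> integrable (lebesgue_on \<Omega>) g \<and> (\<forall>x\<in>\<Omega>. 0 \<le> g x) \<and>
    (AE x in lebesgue_on \<Omega>. \<forall>t\<ge>0. \<Phi> x (2 ^ k * t) \<le> C * \<Phi> x t + g x)"
proof -
  obtain K h where K: "K > 0" "integrable (lebesgue_on \<Omega>) h" "\<forall>x\<in>\<Omega>. 0 \<le> h x"
    and d: "AE x in lebesgue_on \<Omega>. \<forall>t\<ge>0. \<Phi> x (2 * t) \<le> K * \<Phi> x t + h x"
    using assms unfolding delta2_def by (elim exE conjE)
  show ?thesis
  proof (induction k)
    case 0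
    show ?case by (intro exI[of _ 1] exI[of _ "\<lambda>x. 0"]) simp
  next
    case (Suc k)
    then obtain C g where C: "0 \<le> C" "integrable (lebesgue_on \<Omega>) g" "\<forall>x\<in>\<Omega>. 0 \<le> g x"
      and g: "AE x in lebesgue_on \<Omega>. \<forall>t\<ge>0. \<Phi> x (2 ^ k * t) \<le> C * \<Phi> x t + g x"
      by (elim exE conjE)
    have "AE x in lebesgue_on \<Omega>. \<forall>t\<ge>0. \<Phi> x (2 ^ Suc k * t) \<le> (K * C) * \<Phi> x t + (K * g x + h x)"
      using d g
    proof eventually_elim
      case (elim x)
      show ?case
      proof (intro allI impI)
        fix t :: real assume t: "t \<ge> 0"
        have "\<Phi> x (2 ^ Suc k * t) = \<Phi> x (2 * (2 ^ k * t))" by (simp add: mult.assoc)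
        also have "\<dots> \<le> K * \<Phi> x (2 ^ k * t) + h x" using elim(1) t by simp
        also have "\<dots> \<le> K * (C * \<Phi> x t + g x) + h x"
          using elim(2) t K(1) by (intro add_right_mono mult_left_mono) auto
        finally show "\<Phi> x (2 ^ Suc k * t) \<le> (K * C) * \<Phi> x t + (K * g x + h x)"
          by (simp add: algebra_simps)
      qed
    qed
    then show ?case
      using K C by (intro exI[of _ "K * C"] exI[of _ "\<lambda>x. K * g x + h x"]) auto
  qed
qed

text \<open>Jensen's inequality over the signs followed by Khinchine's: pointwise,
  \<open>\<Phi>(x, \<cdot>)\<close> of half the square function is at most the mean of \<open>\<Phi>(x, \<cdot>)\<close> over the signed sums.\<close>

lemma modular_square_function_le_one:
  fixes f :: "nat \<Rightarrow> real \<Rightarrow> complex"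
  assumes MO: "musielak_orlicz \<Omega> \<Phi>" and \<Omega>: "\<Omega> \<in> sets lebesgue"
    and f: "\<And>i. f i \<in> borel_measurable (lebesgue_on \<Omega>)"
    and signs: "\<And>A. A \<subseteq> {..<n} \<Longrightarrow> modular \<Omega> \<Phi> (\<lambda>x. sign_sum (\<lambda>i. f i x) n A) \<le> 1"
  shows "(\<integral>\<^sup>+x. ennreal (\<Phi> x (sqrt (\<Sum>i<n. cmod (f i x) ^ 2) / 2)) \<partial>lebesgue_on \<Omega>) \<le> 1"
proof -
  let ?S = "\<lambda>A x. sign_sum (\<lambda>i. f i x) n A"
  have meas: "(\<lambda>x. ennreal (\<Phi> x (cmod (?S A x)))) \<in> borel_measurable (lebesgue_on \<Omega>)" for A
  proof (rule modular_integrand_measurable[OF MO \<Omega>])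
    show "?S A \<in> borel_measurable (lebesgue_on \<Omega>)"
      unfolding sign_sum_def
    proof (rule borel_measurable_sum)
      show "(\<lambda>x. if i \<in> A then f i x else - f i x) \<in> borel_measurable (lebesgue_on \<Omega>)" for i
        using f by (cases "i \<in> A") auto
    qed
  qed
  have "(\<integral>\<^sup>+x. ennreal (\<Phi> x (sqrt (\<Sum>i<n. cmod (f i x) ^ 2) / 2)) \<partial>lebesgue_on \<Omega>)
      \<le> (\<integral>\<^sup>+x. (\<Sum>A\<in>Pow {..<n}. ennreal (1 / 2 ^ n) * ennreal (\<Phi> x (cmod (?S A x)))) \<partial>lebesgue_on \<Omega>)"
  proof (rule nn_integral_mono_AE)
    show "AE x in lebesgue_on \<Omega>. ennreal (\<Phi> x (sqrt (\<Sum>i<n. cmod (f i x) ^ 2) / 2))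
        \<le> (\<Sum>A\<in>Pow {..<n}. ennreal (1 / 2 ^ n) * ennreal (\<Phi> x (cmod (?S A x))))"
      using musielak_orlicz_AE[OF MO]
    proof eventually_elim
      case (elim x)
      have pos: "0 \<le> \<Phi> x (cmod (?S A x))" for A using orlicz_nonneg[OF elim] by simp
      have "\<Phi> x (sqrt (\<Sum>i<n. cmod (f i x) ^ 2) / 2) \<le> \<Phi> x (sign_mean n (\<lambda>A. cmod (?S A x)))"
        using khinchine[where n = n and a = "\<lambda>i. f i x"] by (intro orlicz_mono[OF elim]) (simp_all add: sum_nonneg)
      also have "\<dots> \<le> sign_mean n (\<lambda>A. \<Phi> x (cmod (?S A x)))"
        using elim by (intro convex_sign_mean[of "{0..}"]) (auto simp: orlicz_function_def)
      also have "\<dots> = (\<Sum>A\<in>Pow {..<n}. 1 / 2 ^ n * \<Phi> x (cmod (?S A x)))"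
        by (simp add: sign_mean_def sum_divide_distrib)
      finally have "ennreal (\<Phi> x (sqrt (\<Sum>i<n. cmod (f i x) ^ 2) / 2))
          \<le> ennreal (\<Sum>A\<in>Pow {..<n}. 1 / 2 ^ n * \<Phi> x (cmod (?S A x)))"
        by (rule ennreal_leI)
      also have "\<dots> = (\<Sum>A\<in>Pow {..<n}. ennreal (1 / 2 ^ n * \<Phi> x (cmod (?S A x))))"
        using pos by (intro sum_ennreal[symmetric]) auto
      also have "\<dots> = (\<Sum>A\<in>Pow {..<n}. ennreal (1 / 2 ^ n) * ennreal (\<Phi> x (cmod (?S A x))))"
        using pos by (intro sum.cong refl ennreal_mult) auto
      finally show ?case .
    qed
  qed
  also have "\<dots> = (\<Sum>A\<in>Pow {..<n}. ennreal (1 / 2 ^ n) * modular \<Omega> \<Phi> (?S A))"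
    unfolding modular_def using meas by (simp add: nn_integral_sum nn_integral_cmult)
  also have "\<dots> \<le> (\<Sum>A\<in>Pow {..<n}. ennreal (1 / 2 ^ n) * 1)"
    using signs by (intro sum_mono mult_left_mono) auto
  also have "\<dots> = 1"
    by (simp add: card_Pow ennreal_of_nat_eq_real_of_nat flip: ennreal_mult)
  finally show ?thesis .
qed

text \<open>Square functions are monotone in the number of terms, so the uniform bound for their modulars
  produces one integrable function \<open>H\<close> above all \<open>\<Phi>(x, \<sigma>\<^sub>n(x))\<close>. Its finiteness forces \<open>f\<^sub>i \<rightarrow> 0\<close> almost
  everywhere, and \<open>\<Delta>\<^sub>2\<close> makes it a majorant at every scale, which dominated convergence needs.\<close>

lemma luxemburg_norm_tendsto_0_if_signs_bounded:
  fixes f :: "nat \<Rightarrow> real \<Rightarrow> complex"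
  assumes MO: "musielak_orlicz \<Omega> \<Phi>" and \<Omega>: "\<Omega> \<in> sets lebesgue" and "delta2 \<Omega> \<Phi>"
    and f: "\<And>i. f i \<in> borel_measurable (lebesgue_on \<Omega>)"
    and signs: "\<And>n A. A \<subseteq> {..<n} \<Longrightarrow> modular \<Omega> \<Phi> (\<lambda>x. sign_sum (\<lambda>i. f i x) n A) \<le> 1"
  shows "(\<lambda>i. luxemburg_norm \<Omega> \<Phi> (f i)) \<longlonglongrightarrow> 0"
proof -
  define \<sigma> where "\<sigma> n x = sqrt (\<Sum>i<n. cmod (f i x) ^ 2) / 2" for n x
  define H where "H x = (SUP n. ennreal (\<Phi> x (\<sigma> n x)))" for x
  have \<sigma>0: "0 \<le> \<sigma> n x" for n x by (simp add: \<sigma>_def sum_nonneg)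
  have \<sigma>_mono: "\<sigma> n x \<le> \<sigma> (Suc n) x" for n x by (simp add: \<sigma>_def)
  have \<sigma>_ge: "cmod (f i x) / 2 \<le> \<sigma> (Suc i) x" for i x
    unfolding \<sigma>_def by (intro divide_right_mono real_le_rsqrt) (simp_all add: sum_nonneg)
  have \<sigma>_meas: "(\<lambda>x. ennreal (\<Phi> x (\<sigma> n x))) \<in> borel_measurable (lebesgue_on \<Omega>)" for n
  proof -
    have "\<sigma> n \<in> borel_measurable (lebesgue_on \<Omega>)" unfolding \<sigma>_def[abs_def] using f by measurable
    then have "(\<lambda>x. \<Phi> x (\<sigma> n x)) \<in> borel_measurable (lebesgue_on \<Omega>)"
      by (intro musielak_orlicz_measurable[OF MO \<Omega>] \<sigma>0)
    then show ?thesis by simp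
  qed
  have H_meas: "H \<in> borel_measurable (lebesgue_on \<Omega>)"
    unfolding H_def[abs_def] using \<sigma>_meas by (intro borel_measurable_SUP) auto
  have "(\<integral>\<^sup>+x. H x \<partial>lebesgue_on \<Omega>) = (SUP n. \<integral>\<^sup>+x. ennreal (\<Phi> x (\<sigma> n x)) \<partial>lebesgue_on \<Omega>)"
    unfolding H_def
  proof (rule nn_integral_monotone_convergence_SUP_AE[OF _ \<sigma>_meas])
    show "AE x in lebesgue_on \<Omega>. ennreal (\<Phi> x (\<sigma> n x)) \<le> ennreal (\<Phi> x (\<sigma> (Suc n) x))" for n
      using musielak_orlicz_AE[OF MO]
    proof eventually_elim
      case (elim x)
      show ?case by (intro ennreal_leI orlicz_mono[OF elim] \<sigma>0 \<sigma>_mono)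
    qed
  qed
  also have "\<dots> \<le> 1"
    using modular_square_function_le_one[OF MO \<Omega> f signs] by (intro SUP_least) (simp add: \<sigma>_def)
  finally have H1: "(\<integral>\<^sup>+x. H x \<partial>lebesgue_on \<Omega>) \<le> 1" .
  then have H_fin: "AE x in lebesgue_on \<Omega>. H x \<noteq> \<infinity>"
    by (intro nn_integral_PInf_AE[OF H_meas]) (auto simp: top_unique)
  have f0: "AE x in lebesgue_on \<Omega>. (\<lambda>i. f i x) \<longlonglongrightarrow> 0"
    using musielak_orlicz_AE[OF MO] H_fin
  proof eventually_elim
    case (elim x)
    obtain r where r: "H x = ennreal r" "0 \<le> r" using elim(2) by (cases "H x") auto
    obtain c b where c: "c > 0" "\<And>t. 0 \<le> t \<Longrightarrow> c * t - b \<le> \<Phi> x t"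
      using orlicz_ge_linear[OF elim(1)] by blast
    define M where "M = (r + b) / c"
    have \<sigma>_le: "\<sigma> n x \<le> M" for n
    proof -
      have "ennreal (\<Phi> x (\<sigma> n x)) \<le> H x" unfolding H_def by (rule SUP_upper) simp
      then have "\<Phi> x (\<sigma> n x) \<le> r" using r by (simp add: ennreal_le_iff)
      then have "c * \<sigma> n x \<le> r + b" using c(2)[OF \<sigma>0, of n x] by linarith
      then show ?thesis using c(1) by (simp add: M_def pos_le_divide_eq mult.commute)
    qed
    have "summable (\<lambda>i. cmod (f i x) ^ 2)"
    proof (rule summableI_nonneg_bounded)
      show "(\<Sum>i<n. cmod (f i x) ^ 2) \<le> (2 * M) ^ 2" for n
      proof -
        have "sqrt (\<Sum>i<n. cmod (f i x) ^ 2) \<le> 2 * M" using \<sigma>_le[of n] by (simp add: \<sigma>_def)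
        then show ?thesis by (rule sqrt_le_D)
      qed
    qed simp
    then have "(\<lambda>i. sqrt (cmod (f i x) ^ 2)) \<longlonglongrightarrow> sqrt 0"
      by (intro tendsto_real_sqrt summable_LIMSEQ_zero)
    then show ?case by (simp add: tendsto_norm_zero_iff)
  qed
  have modular_lim: "(\<lambda>i. modular \<Omega> \<Phi> (\<lambda>x. f i x / complex_of_real l)) \<longlonglongrightarrow> 0" if "l > 0" for l
  proof -
    \<comment> \<open>\<open>\<Delta>\<^sub>2\<close> is applied \<open>k\<close> times to pass from the argument \<open>\<bar>f\<^sub>i\<bar> / 2\<close>, which the square function
      controls, to \<open>\<bar>f\<^sub>i\<bar> / l\<close>.\<close>
    obtain k where k: "2 / l < 2 ^ k" using real_arch_pow[of 2 "2 / l"] by auto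
    obtain C h where C: "0 \<le> C" "integrable (lebesgue_on \<Omega>) h" "\<forall>x\<in>\<Omega>. 0 \<le> h x"
      and d: "AE x in lebesgue_on \<Omega>. \<forall>t\<ge>0. \<Phi> x (2 ^ k * t) \<le> C * \<Phi> x t + h x"
      using delta2_iterate[OF \<open>delta2 \<Omega> \<Phi>\<close>, of k] by (elim exE conjE)
    define W where "W x = ennreal C * H x + ennreal (h x)" for x
    have h_meas: "(\<lambda>x. ennreal (h x)) \<in> borel_measurable (lebesgue_on \<Omega>)" using C(2) by auto
    have "(\<lambda>i. \<integral>\<^sup>+x. ennreal (\<Phi> x (cmod (f i x / complex_of_real l))) \<partial>lebesgue_on \<Omega>)
        \<longlonglongrightarrow> (\<integral>\<^sup>+x. 0 \<partial>lebesgue_on \<Omega>)"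
    proof (rule nn_integral_dominated_convergence[where w = W])
      show "(\<lambda>x. ennreal (\<Phi> x (cmod (f i x / complex_of_real l)))) \<in> borel_measurable (lebesgue_on \<Omega>)" for i
        by (rule modular_integrand_measurable[OF MO \<Omega>]) (use f in auto)
      show "W \<in> borel_measurable (lebesgue_on \<Omega>)"
        unfolding W_def[abs_def] using H_meas h_meas by auto
      have "(\<integral>\<^sup>+x. ennreal (h x) \<partial>lebesgue_on \<Omega>) < \<infinity>"
        using C(2,3) by (subst nn_integral_eq_integral) auto
      then show "(\<integral>\<^sup>+x. W x \<partial>lebesgue_on \<Omega>) < \<infinity>"
        unfolding W_def using H_meas h_meas le_less_trans[OF H1 ennreal_one_less_top]
        by (simp add: nn_integral_add nn_integral_cmult ennreal_mult_less_top)
      show "AE x in lebesgue_on \<Omega>. ennreal (\<Phi> x (cmod (f i x / complex_of_real l))) \<le> W x" for i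
        using musielak_orlicz_AE[OF MO] d AE_space
      proof eventually_elim
        case (elim x)
        have "cmod (f i x / complex_of_real l) = 2 / l * (cmod (f i x) / 2)"
          using that by (simp add: norm_divide)
        also have "\<dots> \<le> 2 ^ k * \<sigma> (Suc i) x"
          using k that \<sigma>_ge by (intro mult_mono) auto
        finally have "\<Phi> x (cmod (f i x / complex_of_real l)) \<le> \<Phi> x (2 ^ k * \<sigma> (Suc i) x)"
          by (intro orlicz_mono[OF elim(1)]) auto
        also have "\<dots> \<le> C * \<Phi> x (\<sigma> (Suc i) x) + h x" using elim(2) \<sigma>0 by blast
        finally have "ennreal (\<Phi> x (cmod (f i x / complex_of_real l))) \<le> ennreal (C * \<Phi> x (\<sigma> (Suc i) x) + h x)"
          by (rule ennreal_leI)
        also have "\<dots> = ennreal C * ennreal (\<Phi> x (\<sigma> (Suc i) x)) + ennreal (h x)"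
          using C(1,3) elim(3) orlicz_nonneg[OF elim(1) \<sigma>0, of "Suc i" x]
          by (subst ennreal_plus) (simp_all add: ennreal_mult)
        also have "\<dots> \<le> W x"
          unfolding W_def H_def by (intro add_right_mono mult_left_mono SUP_upper) auto
        finally show ?case .
      qed
      show "AE x in lebesgue_on \<Omega>. (\<lambda>i. ennreal (\<Phi> x (cmod (f i x / complex_of_real l)))) \<longlonglongrightarrow> 0"
        using musielak_orlicz_AE[OF MO] f0
      proof eventually_elim
        case (elim x)
        have "(\<lambda>i. cmod (f i x / complex_of_real l)) \<longlonglongrightarrow> cmod (0 / complex_of_real l)"
          using that by (intro tendsto_norm tendsto_divide elim(2) tendsto_const) auto
        then have "(\<lambda>i. cmod (f i x / complex_of_real l)) \<longlonglongrightarrow> 0" by simp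
        then have "(\<lambda>i. \<Phi> x (cmod (f i x / complex_of_real l))) \<longlonglongrightarrow> \<Phi> x 0"
          by (rule continuous_on_tendsto_compose[OF orlicz_continuous[OF elim(1)]]) auto
        then show ?case 
          using tendsto_ennrealI[of _ "\<Phi> x 0"] by (simp add: orlicz_zero[OF elim(1)])
      qed
    qed auto
    then show ?thesis by (simp add: modular_def)
  qed
  show ?thesis
  proof (rule order_tendstoI)
    fix a :: ennreal assume "0 < a"
    then obtain z where z: "0 < z" "z < a" using dense by blast
    then obtain l where l: "0 < l" "ennreal l < a" by (cases z) auto
    have "\<forall>\<^sub>F i in sequentially. modular \<Omega> \<Phi> (\<lambda>x. f i x / complex_of_real l) < 1"
      using modular_lim[OF l(1)] by (rule order_tendstoD) simp
    then show "\<forall>\<^sub>F i in sequentially. luxemburg_norm \<Omega> \<Phi> (f i) < a"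
    proof eventually_elim
      case (elim i)
      then have "luxemburg_norm \<Omega> \<Phi> (f i) \<le> ennreal l" by (intro luxemburg_norm_le[OF l(1)]) simp
      then show ?case using l(2) by (rule le_less_trans)
    qed
  qed simp
qed

section \<open>The metric space of Sobolev classes\<close>

definition weakly_differentiable :: "real set \<Rightarrow> (real \<Rightarrow> complex) \<Rightarrow> bool" where
  "weakly_differentiable \<Omega> f \<longleftrightarrow> (\<exists>g. is_weak_deriv \<Omega> f g)"

lemma weak_deriv_is_weak_deriv:
  assumes "weakly_differentiable \<Omega> f"
  shows "is_weak_deriv \<Omega> f (weak_deriv \<Omega> f)"
proof -
  obtain g where "is_weak_deriv \<Omega> f g" using assms by (auto simp: weakly_differentiable_def)
  then show ?thesis unfolding weak_deriv_def by (rule someI[of "is_weak_deriv \<Omega> f"])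
qed

lemma sobolev_functions_iff:
  "f \<in> sobolev_functions \<Omega> \<Phi> \<longleftrightarrow> weakly_differentiable \<Omega> f \<and> sobolev_norm \<Omega> \<Phi> f < \<infinity>"
  by (auto simp: sobolev_functions_def weakly_differentiable_def is_weak_deriv_def)

lemma weakly_differentiable_measurable:
  assumes "weakly_differentiable {\<alpha><..<\<beta>} f"
  shows "f \<in> borel_measurable (lebesgue_on {\<alpha><..<\<beta>})"
    and "weak_deriv {\<alpha><..<\<beta>} f \<in> borel_measurable (lebesgue_on {\<alpha><..<\<beta>})"
  using weak_deriv_is_weak_deriv[OF assms] locally_integrable_measurable
  by (auto simp: is_weak_deriv_def)

lemma weak_deriv_eq_AE:
  assumes "is_weak_deriv {\<alpha><..<\<beta>} f g"
  shows "AE x in lebesgue_on {\<alpha><..<\<beta>}. weak_deriv {\<alpha><..<\<beta>} f x = g x"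
proof (rule is_weak_deriv_unique[OF weak_deriv_is_weak_deriv assms])
  show "weakly_differentiable {\<alpha><..<\<beta>} f" using assms by (auto simp: weakly_differentiable_def)
qed

lemma is_weak_deriv_combination:
  assumes "weakly_differentiable {\<alpha><..<\<beta>} f" "weakly_differentiable {\<alpha><..<\<beta>} g"
  shows "is_weak_deriv {\<alpha><..<\<beta>} (\<lambda>x. f x + c * g x)
    (\<lambda>x. weak_deriv {\<alpha><..<\<beta>} f x + c * weak_deriv {\<alpha><..<\<beta>} g x)"
  by (intro is_weak_deriv_add is_weak_deriv_cmult weak_deriv_is_weak_deriv assms) simp

lemma weakly_differentiable_combination:
  assumes "weakly_differentiable {\<alpha><..<\<beta>} f" "weakly_differentiable {\<alpha><..<\<beta>} g"
  shows "weakly_differentiable {\<alpha><..<\<beta>} (\<lambda>x. f x + c * g x)"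
  using is_weak_deriv_combination[OF assms] by (auto simp: weakly_differentiable_def)

lemma is_weak_deriv_zero: "is_weak_deriv \<Omega> (\<lambda>x. 0) (\<lambda>x. 0)"
  by (simp add: is_weak_deriv_def locally_integrable_def)

locale musielak_orlicz_interval =
  fixes \<alpha> \<beta> :: real and \<Phi> :: "real \<Rightarrow> real \<Rightarrow> real"
  assumes MO: "musielak_orlicz {\<alpha><..<\<beta>} \<Phi>"
begin

abbreviation \<Omega> :: "real set" where "\<Omega> \<equiv> {\<alpha><..<\<beta>}"
abbreviation SF :: "(real \<Rightarrow> complex) set" where "SF \<equiv> sobolev_functions \<Omega> \<Phi>"
abbreviation SN :: "(real \<Rightarrow> complex) \<Rightarrow> ennreal" where "SN \<equiv> sobolev_norm \<Omega> \<Phi>"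
abbreviation cls :: "(real \<Rightarrow> complex) \<Rightarrow> (real \<Rightarrow> complex) set" where "cls f \<equiv> ae_eq \<Omega> `` {f}"

lemma sets_\<Omega>: "\<Omega> \<in> sets lebesgue" by simp

lemma sobolev_functionsD:
  assumes "f \<in> SF"
  shows "weakly_differentiable \<Omega> f" "SN f < \<infinity>" "f \<in> borel_measurable (lebesgue_on \<Omega>)"
  using assms weakly_differentiable_measurable(1) by (auto simp: sobolev_functions_iff)

lemma sobolev_norm_eq:
  assumes "is_weak_deriv \<Omega> f g"
  shows "SN f = luxemburg_norm \<Omega> \<Phi> f + luxemburg_norm \<Omega> \<Phi> g"
proof -
  have "AE x in lebesgue_on \<Omega>. cmod (weak_deriv \<Omega> f x) = cmod (g x)"
    using weak_deriv_eq_AE[OF assms] by eventually_elim simp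
  then show ?thesis by (simp add: sobolev_norm_def luxemburg_norm_cong_cmod)
qed

lemma sobolev_norm_cong:
  assumes "f \<in> borel_measurable (lebesgue_on \<Omega>)" "g \<in> borel_measurable (lebesgue_on \<Omega>)"
    and ae: "AE x in lebesgue_on \<Omega>. f x = g x"
  shows "SN f = SN g" "f \<in> SF \<longleftrightarrow> g \<in> SF"
proof -
  have ae': "AE x in lebesgue_on \<Omega>. g x = f x" using ae by eventually_elim simp
  have w: "is_weak_deriv \<Omega> f = is_weak_deriv \<Omega> g"
    using is_weak_deriv_cong_AE[OF assms sets_\<Omega>] is_weak_deriv_cong_AE[OF assms(2,1) ae' sets_\<Omega>]
    by blast
  have "AE x in lebesgue_on \<Omega>. cmod (f x) = cmod (g x)" using ae by eventually_elim simp
  then show "SN f = SN g"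
    by (simp add: sobolev_norm_def weak_deriv_def w luxemburg_norm_cong_cmod)
  then show "f \<in> SF \<longleftrightarrow> g \<in> SF"
    by (simp add: sobolev_functions_iff weakly_differentiable_def w)
qed

lemma sobolev_norm_zero: "SN (\<lambda>x. 0) = 0"
  using sobolev_norm_eq[OF is_weak_deriv_zero] luxemburg_norm_zero[OF MO, of "\<lambda>x. 0"] by simp

lemma sobolev_norm_eq_zero_imp:
  assumes "weakly_differentiable \<Omega> f" "SN f = 0"
  shows "AE x in lebesgue_on \<Omega>. f x = 0"
proof (rule luxemburg_norm_eq_zero_imp[OF MO sets_\<Omega>])
  show "f \<in> borel_measurable (lebesgue_on \<Omega>)" by (rule weakly_differentiable_measurable[OF assms(1)])
  show "luxemburg_norm \<Omega> \<Phi> f = 0" using assms(2) by (simp add: sobolev_norm_def add_eq_0_iff_both_eq_0)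
qed

lemma sobolev_norm_triangle:
  assumes "weakly_differentiable \<Omega> f" "weakly_differentiable \<Omega> g" "cmod c = 1"
  shows "SN (\<lambda>x. f x + c * g x) \<le> SN f + SN g"
proof -
  have lux: "luxemburg_norm \<Omega> \<Phi> (\<lambda>x. u x + c * v x) \<le> luxemburg_norm \<Omega> \<Phi> u + luxemburg_norm \<Omega> \<Phi> v"
    if "u \<in> borel_measurable (lebesgue_on \<Omega>)" "v \<in> borel_measurable (lebesgue_on \<Omega>)" for u v
  proof -
    have "luxemburg_norm \<Omega> \<Phi> (\<lambda>x. u x + c * v x) \<le> luxemburg_norm \<Omega> \<Phi> u + luxemburg_norm \<Omega> \<Phi> (\<lambda>x. c * v x)"
      by (rule luxemburg_norm_triangle[OF MO sets_\<Omega>]) (use that in auto)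
    also have "luxemburg_norm \<Omega> \<Phi> (\<lambda>x. c * v x) = luxemburg_norm \<Omega> \<Phi> v"
      by (rule luxemburg_norm_cong_cmod) (simp add: norm_mult assms(3))
    finally show ?thesis .
  qed
  have "SN (\<lambda>x. f x + c * g x) = luxemburg_norm \<Omega> \<Phi> (\<lambda>x. f x + c * g x)
      + luxemburg_norm \<Omega> \<Phi> (\<lambda>x. weak_deriv \<Omega> f x + c * weak_deriv \<Omega> g x)"
    by (rule sobolev_norm_eq[OF is_weak_deriv_combination[OF assms(1,2)]])
  also have "\<dots> \<le> (luxemburg_norm \<Omega> \<Phi> f + luxemburg_norm \<Omega> \<Phi> g)
      + (luxemburg_norm \<Omega> \<Phi> (weak_deriv \<Omega> f) + luxemburg_norm \<Omega> \<Phi> (weak_deriv \<Omega> g))"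
    by (intro add_mono lux weakly_differentiable_measurable assms)
  also have "\<dots> = SN f + SN g" by (simp add: sobolev_norm_def ac_simps)
  finally show ?thesis .
qed

lemma sobolev_functions_combination:
  assumes "f \<in> SF" "g \<in> SF" "cmod c = 1"
  shows "(\<lambda>x. f x + c * g x) \<in> SF"
proof -
  have w: "weakly_differentiable \<Omega> f" "weakly_differentiable \<Omega> g"
    using assms(1,2) sobolev_functionsD by auto
  have "SN f + SN g < \<infinity>" using sobolev_functionsD(2)[OF assms(1)] sobolev_functionsD(2)[OF assms(2)] by simp
  then have "SN (\<lambda>x. f x + c * g x) < \<infinity>"
    using sobolev_norm_triangle[OF w assms(3)] by (rule le_less_trans[rotated])
  then show ?thesis using weakly_differentiable_combination[OF w] by (simp add: sobolev_functions_iff)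
qed

lemma ae_eq_refl: "f \<in> borel_measurable (lebesgue_on \<Omega>) \<Longrightarrow> (f, f) \<in> ae_eq \<Omega>"
  by (simp add: ae_eq_def)

lemma ae_eq_class_eq:
  assumes "(f, g) \<in> ae_eq \<Omega>"
  shows "cls f = cls g"
proof -
  have 1: "f \<in> borel_measurable (lebesgue_on \<Omega>)" "g \<in> borel_measurable (lebesgue_on \<Omega>)"
    and 2: "AE x in lebesgue_on \<Omega>. f x = g x" using assms by (auto simp: ae_eq_def)
  have "(AE x in lebesgue_on \<Omega>. f x = h x) = (AE x in lebesgue_on \<Omega>. g x = h x)" for h
  proof
    assume "AE x in lebesgue_on \<Omega>. f x = h x"
    then show "AE x in lebesgue_on \<Omega>. g x = h x" using 2 by eventually_elim simp
  next
    assume "AE x in lebesgue_on \<Omega>. g x = h x"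
    then show "AE x in lebesgue_on \<Omega>. f x = h x" using 2 by eventually_elim simp
  qed
  then show ?thesis using 1 by (auto simp: ae_eq_def)
qed

lemma sobolev_spaceD:
  assumes "A \<in> sobolev_space \<Omega> \<Phi>" "f \<in> A"
  shows "f \<in> SF" "A = cls f" "class_norm \<Omega> \<Phi> A = enn2real (SN f)"
proof -
  obtain g where g: "g \<in> SF" "A = cls g"
    using assms(1) by (auto simp: sobolev_space_def quotient_def)
  then have gf: "(g, f) \<in> ae_eq \<Omega>" using assms(2) by simp
  show A: "A = cls f" using g(2) ae_eq_class_eq[OF gf] by simp
  show "f \<in> SF"
    using gf g(1) sobolev_norm_cong(2)[of g f] by (simp add: ae_eq_def)
  have "SN ` A = {SN f}"
  proof -
    have "SN h = SN f" if "h \<in> A" for h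
      using that sobolev_norm_cong(1)[of f h] by (auto simp: A ae_eq_def)
    then show ?thesis using assms(2) by blast
  qed
  then show "class_norm \<Omega> \<Phi> A = enn2real (SN f)" by (simp add: class_norm_def)
qed

lemma sobolev_class_nonempty:
  assumes "A \<in> sobolev_space \<Omega> \<Phi>"
  obtains f where "f \<in> A"
proof -
  obtain g where g: "g \<in> SF" "A = cls g"
    using assms by (auto simp: sobolev_space_def quotient_def)
  then have "g \<in> A" using ae_eq_refl sobolev_functionsD(3)[OF g(1)] by simp
  then show thesis by (rule that)
qed

lemma class_scale_mem:
  assumes "f \<in> A" "f \<in> borel_measurable (lebesgue_on \<Omega>)"
  shows "(\<lambda>x. c * f x) \<in> class_scale \<Omega> c A"
  unfolding class_scale_def using assms by (intro UN_I[OF assms(1)]) (auto intro: ae_eq_refl)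

lemma class_add_mem:
  assumes "f \<in> A" "g \<in> B" "f \<in> borel_measurable (lebesgue_on \<Omega>)" "g \<in> borel_measurable (lebesgue_on \<Omega>)"
  shows "(\<lambda>x. f x + g x) \<in> class_add \<Omega> A B"
  unfolding class_add_def using assms by (intro UN_I[OF assms(1)] UN_I[OF assms(2)]) (auto intro: ae_eq_refl)

text \<open>Valid for arbitrary sets of functions, not only for classes, because the distance must be
  symmetric on all sets to qualify as a metric.\<close>

lemma class_diff_eq:
  "class_add \<Omega> A (class_scale \<Omega> (- 1) B) =
    {k \<in> borel_measurable (lebesgue_on \<Omega>). \<exists>f\<in>A \<inter> borel_measurable (lebesgue_on \<Omega>).
        \<exists>g\<in>B \<inter> borel_measurable (lebesgue_on \<Omega>). AE x in lebesgue_on \<Omega>. k x = f x + (- 1) * g x}"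
proof (intro antisym subsetI)
  fix k assume "k \<in> class_add \<Omega> A (class_scale \<Omega> (- 1) B)"
  then obtain f g h where f: "f \<in> A" and g: "g \<in> B"
    and h: "(\<lambda>x. - 1 * g x, h) \<in> ae_eq \<Omega>" and k: "(\<lambda>x. f x + h x, k) \<in> ae_eq \<Omega>"
    unfolding class_add_def class_scale_def by blast
  have meas: "(\<lambda>x. - 1 * g x) \<in> borel_measurable (lebesgue_on \<Omega>)" "h \<in> borel_measurable (lebesgue_on \<Omega>)"
    "(\<lambda>x. f x + h x) \<in> borel_measurable (lebesgue_on \<Omega>)" "k \<in> borel_measurable (lebesgue_on \<Omega>)"
    using h k by (auto simp: ae_eq_def)
  have "g \<in> borel_measurable (lebesgue_on \<Omega>)"
    using borel_measurable_uminus[OF meas(1)] by simp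
  moreover have "f \<in> borel_measurable (lebesgue_on \<Omega>)"
    using borel_measurable_diff[OF meas(3,2)] by simp
  moreover have "AE x in lebesgue_on \<Omega>. - 1 * g x = h x" "AE x in lebesgue_on \<Omega>. f x + h x = k x"
    using h k by (auto simp: ae_eq_def)
  then have "AE x in lebesgue_on \<Omega>. k x = f x + (- 1) * g x" by eventually_elim auto
  ultimately show "k \<in> {k \<in> borel_measurable (lebesgue_on \<Omega>). \<exists>f\<in>A \<inter> borel_measurable (lebesgue_on \<Omega>).
        \<exists>g\<in>B \<inter> borel_measurable (lebesgue_on \<Omega>). AE x in lebesgue_on \<Omega>. k x = f x + (- 1) * g x}"
    using f g meas(4) by blast
next
  fix k assume "k \<in> {k \<in> borel_measurable (lebesgue_on \<Omega>). \<exists>f\<in>A \<inter> borel_measurable (lebesgue_on \<Omega>).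
        \<exists>g\<in>B \<inter> borel_measurable (lebesgue_on \<Omega>). AE x in lebesgue_on \<Omega>. k x = f x + (- 1) * g x}"
  then obtain f g where fg: "f \<in> A" "g \<in> B" and meas: "k \<in> borel_measurable (lebesgue_on \<Omega>)"
      "f \<in> borel_measurable (lebesgue_on \<Omega>)" "g \<in> borel_measurable (lebesgue_on \<Omega>)"
    and ae: "AE x in lebesgue_on \<Omega>. k x = f x + (- 1) * g x" by blast
  have "AE x in lebesgue_on \<Omega>. f x + (- 1) * g x = k x" using ae by eventually_elim simp
  moreover have "(\<lambda>x. f x + (- 1) * g x) \<in> borel_measurable (lebesgue_on \<Omega>)" using meas by auto
  ultimately have "(\<lambda>x. f x + (- 1) * g x, k) \<in> ae_eq \<Omega>" using meas(1) by (simp add: ae_eq_def)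
  then show "k \<in> class_add \<Omega> A (class_scale \<Omega> (- 1) B)"
    unfolding class_add_def using fg(1) class_scale_mem[OF fg(2) meas(3), of "- 1"]
    by (intro UN_I[OF fg(1)] UN_I[where a = "\<lambda>x. - 1 * g x"]) auto
qed

text \<open>This holds even if \<open>f\<close> has no weak derivative: then neither has \<open>-f\<close>, and both sides use the same
  default value of the choice operator.\<close>

lemma sobolev_norm_uminus: "SN (\<lambda>x. - f x) = SN f"
proof (cases "weakly_differentiable \<Omega> f")
  case True
  have "is_weak_deriv \<Omega> (\<lambda>x. (- 1) * f x) (\<lambda>x. (- 1) * weak_deriv \<Omega> f x)"
    by (rule is_weak_deriv_cmult[OF weak_deriv_is_weak_deriv[OF True]])
  then have "SN (\<lambda>x. - f x) = luxemburg_norm \<Omega> \<Phi> (\<lambda>x. - f x) + luxemburg_norm \<Omega> \<Phi> (\<lambda>x. - weak_deriv \<Omega> f x)"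
    using sobolev_norm_eq by simp
  then show ?thesis
    using luxemburg_norm_cong_cmod[where \<Omega> = \<Omega> and f = "\<lambda>x. - f x" and g = f and \<Phi> = \<Phi>]
      luxemburg_norm_cong_cmod[where \<Omega> = \<Omega> and f = "\<lambda>x. - weak_deriv \<Omega> f x" and g = "weak_deriv \<Omega> f" and \<Phi> = \<Phi>]
    by (simp add: sobolev_norm_def)
next
  case False
  have "\<not> is_weak_deriv \<Omega> (\<lambda>x. - f x) g" for g
    using is_weak_deriv_cmult[of \<Omega> "\<lambda>x. - f x" g "- 1"] False by (auto simp: weakly_differentiable_def)
  then have "is_weak_deriv \<Omega> (\<lambda>x. - f x) = is_weak_deriv \<Omega> f"
    using False by (auto simp: weakly_differentiable_def)
  then show ?thesis
    using luxemburg_norm_cong_cmod[where \<Omega> = \<Omega> and f = "\<lambda>x. - f x" and g = f and \<Phi> = \<Phi>]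
    by (simp add: sobolev_norm_def weak_deriv_def)
qed

definition class_dist :: "(real \<Rightarrow> complex) set \<Rightarrow> (real \<Rightarrow> complex) set \<Rightarrow> real" where
  "class_dist A B = class_norm \<Omega> \<Phi> (class_add \<Omega> A (class_scale \<Omega> (- 1) B))"

lemma class_dist_eq:
  assumes A: "A \<in> sobolev_space \<Omega> \<Phi>" "f \<in> A" and B: "B \<in> sobolev_space \<Omega> \<Phi>" "g \<in> B"
  shows "ennreal (class_dist A B) = SN (\<lambda>x. f x + (- 1) * g x)"
proof -
  let ?h = "\<lambda>x. f x + (- 1) * g x"
  have h: "?h \<in> SF"
    by (intro sobolev_functions_combination sobolev_spaceD(1)[OF A] sobolev_spaceD(1)[OF B]) simp
  have fm: "f \<in> borel_measurable (lebesgue_on \<Omega>)" and gm: "g \<in> borel_measurable (lebesgue_on \<Omega>)"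
    using sobolev_functionsD(3)[OF sobolev_spaceD(1)[OF A]] sobolev_functionsD(3)[OF sobolev_spaceD(1)[OF B]] .
  have "SN ` class_add \<Omega> A (class_scale \<Omega> (- 1) B) = {SN ?h}"
  proof -
    have "SN k = SN ?h" if k: "k \<in> class_add \<Omega> A (class_scale \<Omega> (- 1) B)" for k
    proof -
      obtain f' g' where f': "f' \<in> A" and g': "g' \<in> B" and km: "k \<in> borel_measurable (lebesgue_on \<Omega>)"
        and ae: "AE x in lebesgue_on \<Omega>. k x = f' x + (- 1) * g' x"
        using k unfolding class_diff_eq by blast
      have "AE x in lebesgue_on \<Omega>. f x = f' x" "AE x in lebesgue_on \<Omega>. g x = g' x"
        using f' g' sobolev_spaceD(2)[OF A] sobolev_spaceD(2)[OF B] by (auto simp: ae_eq_def)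
      with ae have "AE x in lebesgue_on \<Omega>. k x = ?h x" by eventually_elim simp
      then show ?thesis by (intro sobolev_norm_cong(1) km sobolev_functionsD(3)[OF h])
    qed
    moreover have "?h \<in> class_add \<Omega> A (class_scale \<Omega> (- 1) B)"
      using class_add_mem[OF A(2) class_scale_mem[OF B(2) gm] fm, of "- 1"] gm by simp
    ultimately show ?thesis by blast
  qed
  then show ?thesis
    using sobolev_functionsD(2)[OF h] by (simp add: class_dist_def class_norm_def)
qed

lemma sobolev_Metric_space: "Metric_space (sobolev_space \<Omega> \<Phi>) class_dist"
proof
  show "0 \<le> class_dist A B" for A B by (simp add: class_dist_def class_norm_def)
  show "class_dist A B = class_dist B A" for A B
  proof -
    have "SN ` class_add \<Omega> A (class_scale \<Omega> (- 1) B) \<subseteq> SN ` class_add \<Omega> B (class_scale \<Omega> (- 1) A)" for A B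
    proof
      fix s assume "s \<in> SN ` class_add \<Omega> A (class_scale \<Omega> (- 1) B)"
      then obtain k f g where s: "s = SN k" and fg: "f \<in> A" "g \<in> B"
        and meas: "k \<in> borel_measurable (lebesgue_on \<Omega>)"
          "f \<in> borel_measurable (lebesgue_on \<Omega>)" "g \<in> borel_measurable (lebesgue_on \<Omega>)"
        and ae: "AE x in lebesgue_on \<Omega>. k x = f x + (- 1) * g x"
        unfolding class_diff_eq by blast
      have "AE x in lebesgue_on \<Omega>. - k x = g x + (- 1) * f x" using ae by eventually_elim simp
      moreover have "(\<lambda>x. - k x) \<in> borel_measurable (lebesgue_on \<Omega>)" using meas(1) by simp
      ultimately have "(\<lambda>x. - k x) \<in> class_add \<Omega> B (class_scale \<Omega> (- 1) A)"
        using fg meas(2,3) unfolding class_diff_eq by blast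
      then show "s \<in> SN ` class_add \<Omega> B (class_scale \<Omega> (- 1) A)"
        using sobolev_norm_uminus[of k] s by (metis image_eqI)
    qed
    then have "SN ` class_add \<Omega> A (class_scale \<Omega> (- 1) B) = SN ` class_add \<Omega> B (class_scale \<Omega> (- 1) A)"
      by (intro antisym)
    then show ?thesis by (simp add: class_dist_def class_norm_def)
  qed
  fix A B C assume A: "A \<in> sobolev_space \<Omega> \<Phi>" and B: "B \<in> sobolev_space \<Omega> \<Phi>"
  obtain f where f: "f \<in> A" using sobolev_class_nonempty[OF A] .
  obtain g where g: "g \<in> B" using sobolev_class_nonempty[OF B] .
  note D = class_dist_eq[OF A f B g]
  note wf = sobolev_functionsD(1)[OF sobolev_spaceD(1)[OF A f]]
    and wg = sobolev_functionsD(1)[OF sobolev_spaceD(1)[OF B g]]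
  show "class_dist A B = 0 \<longleftrightarrow> A = B"
  proof
    assume "class_dist A B = 0"
    then have "SN (\<lambda>x. f x + (- 1) * g x) = 0" using D by simp
    then have "AE x in lebesgue_on \<Omega>. f x + (- 1) * g x = 0"
      by (rule sobolev_norm_eq_zero_imp[OF weakly_differentiable_combination[OF wf wg]])
    then have "AE x in lebesgue_on \<Omega>. f x = g x" by eventually_elim simp
    then have "(f, g) \<in> ae_eq \<Omega>"
      using weakly_differentiable_measurable(1)[OF wf] weakly_differentiable_measurable(1)[OF wg]
      by (simp add: ae_eq_def)
    then show "A = B"
      using ae_eq_class_eq sobolev_spaceD(2)[OF A f] sobolev_spaceD(2)[OF B g] by simp
  next
    assume "A = B"
    then have "ennreal (class_dist A B) = 0"
      using class_dist_eq[OF A f A f] by (simp add: sobolev_norm_zero)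
    then have "class_dist A B \<le> 0" by (simp add: ennreal_eq_0_iff)
    moreover have "0 \<le> class_dist A B" by (simp add: class_dist_def class_norm_def)
    ultimately show "class_dist A B = 0" by simp
  qed
  assume C: "C \<in> sobolev_space \<Omega> \<Phi>"
  obtain h where h: "h \<in> C" using sobolev_class_nonempty[OF C] .
  note wh = sobolev_functionsD(1)[OF sobolev_spaceD(1)[OF C h]]
  have "SN (\<lambda>x. (f x + (- 1) * g x) + 1 * (g x + (- 1) * h x)) \<le> SN (\<lambda>x. f x + (- 1) * g x) + SN (\<lambda>x. g x + (- 1) * h x)"
    by (rule sobolev_norm_triangle[OF weakly_differentiable_combination[OF wf wg]
        weakly_differentiable_combination[OF wg wh]]) simp
  then have "ennreal (class_dist A C) \<le> ennreal (class_dist A B) + ennreal (class_dist B C)"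
    unfolding class_dist_eq[OF A f C h] D class_dist_eq[OF B g C h] by simp
  then show "class_dist A C \<le> class_dist A B + class_dist B C"
    by (simp add: class_dist_def class_norm_def flip: ennreal_plus)
qed

end

section \<open>Embeddings of the space of bounded sequences\<close>

lemma is_weak_deriv_sign_sum:
  assumes "\<And>i. weakly_differentiable {\<alpha><..<\<beta>} (f i)"
  shows "is_weak_deriv {\<alpha><..<\<beta>} (\<lambda>x. sign_sum (\<lambda>i. f i x) n A)
    (\<lambda>x. sign_sum (\<lambda>i. weak_deriv {\<alpha><..<\<beta>} (f i) x) n A)"
proof (induction n)
  case 0
  show ?case by (simp add: sign_sum_def is_weak_deriv_zero)
next
  case (Suc n)
  let ?c = "if n \<in> A then 1 else - 1 :: complex"
  have eq: "sign_sum a (Suc n) A = sign_sum a n A + ?c * a n" for a :: "nat \<Rightarrow> complex"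
    by (simp add: sign_sum_def)
  show ?case
    unfolding eq
    by (intro is_weak_deriv_add is_weak_deriv_cmult Suc.IH weak_deriv_is_weak_deriv assms) simp
qed

definition linf_unit :: "real \<Rightarrow> nat \<Rightarrow> linf" where
  "linf_unit c n = Bcontfun (\<lambda>k. if k = n then complex_of_real c else 0)"

lemma apply_linf_unit: "apply_bcontfun (linf_unit c n) k = (if k = n then complex_of_real c else 0)"
proof -
  have "range (\<lambda>k. if k = n then complex_of_real c else 0) \<subseteq> {complex_of_real c, 0}" by auto
  then have "bounded (range (\<lambda>k. if k = n then complex_of_real c else 0))"
    by (rule bounded_subset[rotated]) simp
  then have "(\<lambda>k. if k = n then complex_of_real c else 0) \<in> bcontfun"
    by (simp add: bcontfun_def)
  then show ?thesis by (simp add: linf_unit_def Bcontfun_inverse)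
qed

lemma norm_linf_unit_ge: "\<bar>c\<bar> \<le> norm (linf_unit c n)"
  using norm_bounded[of "linf_unit c n" n] by (simp add: apply_linf_unit)

lemma apply_sign_sum_linf_unit:
  "apply_bcontfun (sign_sum (linf_unit c) n A) k =
    (if k < n then if k \<in> A then complex_of_real c else - complex_of_real c else 0)"
proof (induction n)
  case 0
  show ?case by (simp add: sign_sum_def)
next
  case (Suc n)
  have "sign_sum (linf_unit c) (Suc n) A = sign_sum (linf_unit c) n A + (if n \<in> A then linf_unit c n else - linf_unit c n)"
    by (simp add: sign_sum_def)
  then show ?case
    using Suc by (auto simp: plus_bcontfun.rep_eq uminus_bcontfun.rep_eq apply_linf_unit less_Suc_eq)
qed

lemma norm_sign_sum_linf_unit_le: "norm (sign_sum (linf_unit c) n A) \<le> \<bar>c\<bar>"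
  by (rule norm_bound) (simp add: apply_sign_sum_linf_unit)

context musielak_orlicz_interval
begin

text \<open>The result for \<open>L\<^sup>\<Phi>\<close> is applied to the functions and to their weak derivatives. Uniqueness of weak
  derivatives identifies the derivative of a signed sum.\<close>

lemma sobolev_norm_tendsto_0_if_signs_bounded:
  assumes "delta2 \<Omega> \<Phi>" and wd: "\<And>i. weakly_differentiable \<Omega> (f i)"
    and signs: "\<And>n A. SN (\<lambda>x. sign_sum (\<lambda>i. f i x) n A) < 1"
  shows "(\<lambda>i. SN (f i)) \<longlonglongrightarrow> 0"
proof -
  have lim: "(\<lambda>i. luxemburg_norm \<Omega> \<Phi> (g i)) \<longlonglongrightarrow> 0"
    if meas: "\<And>i. g i \<in> borel_measurable (lebesgue_on \<Omega>)"
      and less: "\<And>n A. luxemburg_norm \<Omega> \<Phi> (\<lambda>x. sign_sum (\<lambda>i. g i x) n A) < 1" for g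
  proof (rule luxemburg_norm_tendsto_0_if_signs_bounded[OF MO sets_\<Omega> assms(1) meas])
    show "modular \<Omega> \<Phi> (\<lambda>x. sign_sum (\<lambda>i. g i x) n A) \<le> 1" for n A
      using modular_le_one_if_luxemburg_less[OF MO, of "\<lambda>x. sign_sum (\<lambda>i. g i x) n A" 1] less by simp
  qed
  have split: "SN (\<lambda>x. sign_sum (\<lambda>i. f i x) n A) = luxemburg_norm \<Omega> \<Phi> (\<lambda>x. sign_sum (\<lambda>i. f i x) n A)
      + luxemburg_norm \<Omega> \<Phi> (\<lambda>x. sign_sum (\<lambda>i. weak_deriv \<Omega> (f i) x) n A)" for n A
    by (rule sobolev_norm_eq[OF is_weak_deriv_sign_sum[OF wd]])
  have "(\<lambda>i. luxemburg_norm \<Omega> \<Phi> (f i)) \<longlonglongrightarrow> 0"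
  proof (rule lim)
    show "f i \<in> borel_measurable (lebesgue_on \<Omega>)" for i
      by (rule weakly_differentiable_measurable(1)[OF wd])
    show "luxemburg_norm \<Omega> \<Phi> (\<lambda>x. sign_sum (\<lambda>i. f i x) n A) < 1" for n A
      using signs[of n A] unfolding split by (rule le_less_trans[rotated]) simp
  qed
  moreover have "(\<lambda>i. luxemburg_norm \<Omega> \<Phi> (weak_deriv \<Omega> (f i))) \<longlonglongrightarrow> 0"
  proof (rule lim)
    show "weak_deriv \<Omega> (f i) \<in> borel_measurable (lebesgue_on \<Omega>)" for i
      by (rule weakly_differentiable_measurable(2)[OF wd])
    show "luxemburg_norm \<Omega> \<Phi> (\<lambda>x. sign_sum (\<lambda>i. weak_deriv \<Omega> (f i) x) n A) < 1" for n A
      using signs[of n A] unfolding split by (rule le_less_trans[rotated]) simp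
  qed
  ultimately have "(\<lambda>i. luxemburg_norm \<Omega> \<Phi> (f i) + luxemburg_norm \<Omega> \<Phi> (weak_deriv \<Omega> (f i))) \<longlonglongrightarrow> 0 + 0"
    by (rule tendsto_add)
  then show ?thesis by (simp add: sobolev_norm_def)
qed

lemma linf_copy_imp_not_delta2:
  assumes "contains_linf_copy \<Omega> \<Phi>"
  shows "\<not> delta2 \<Omega> \<Phi>"
proof
  assume d2: "delta2 \<Omega> \<Phi>"
  obtain V and T :: "linf \<Rightarrow> (real \<Rightarrow> complex) set" where V: "sobolev_subspace \<Omega> \<Phi> V"
    and T_add: "\<And>x y. T (x + y) = class_add \<Omega> (T x) (T y)"
    and T_scale: "\<And>c x. T (linf_scale c x) = class_scale \<Omega> c (T x)"
    and homeo: "homeomorphic_map euclidean (subtopology (sobolev_topology \<Omega> \<Phi>) V) T"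
    using assms unfolding contains_linf_copy_def by blast
  interpret Metric_space "sobolev_space \<Omega> \<Phi>" class_dist by (rule sobolev_Metric_space)
  have topo: "sobolev_topology \<Omega> \<Phi> = mtopology"
    unfolding sobolev_topology_def class_dist_def[abs_def] ..
  have VM: "V \<subseteq> sobolev_space \<Omega> \<Phi>" using V by (simp add: sobolev_subspace_def)
  have TV: "T x \<in> V" for x
    using homeomorphic_imp_surjective_map[OF homeo] VM by (auto simp: topo)
  then have TM: "T x \<in> sobolev_space \<Omega> \<Phi>" for x using VM by blast
  have T_diff: "class_dist (T x) (T y) = class_norm \<Omega> \<Phi> (T (x - y))" for x y
  proof -
    have "x - y = x + linf_scale (- 1) y"
      by (rule bcontfun_eqI) (simp add: minus_bcontfun.rep_eq plus_bcontfun.rep_eq)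
    then show ?thesis by (simp only: class_dist_def T_add T_scale)
  qed
  have norm_T: "class_norm \<Omega> \<Phi> (T x) = class_dist (T 0) (T x)" for x
    using T_diff[of x 0] commute by simp
  \<comment> \<open>continuity of \<open>T\<close> at \<open>0\<close>\<close>
  obtain \<delta> where \<delta>: "\<delta> > 0" "\<And>x. norm x < \<delta> \<Longrightarrow> class_norm \<Omega> \<Phi> (T x) < 1"
  proof -
    have "continuous_map euclidean mtopology T"
      using homeomorphic_imp_continuous_map[OF homeo] by (simp add: topo continuous_map_in_subtopology)
    then have "open {x. T x \<in> mball (T 0) 1}"
      using openin_continuous_map_preimage[OF _ openin_mball] by fastforce
    moreover have "0 \<in> {x. T x \<in> mball (T 0) 1}" using TM by simp
    ultimately obtain \<delta> where "\<delta> > 0" "ball 0 \<delta> \<subseteq> {x. T x \<in> mball (T 0) 1}"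
      by (meson open_contains_ball)
    then show thesis by (intro that[of \<delta>]) (auto simp: norm_T subset_iff)
  qed
  \<comment> \<open>continuity of the inverse of \<open>T\<close> at \<open>T 0\<close>\<close>
  obtain r where r: "r > 0" "\<And>x. class_norm \<Omega> \<Phi> (T x) < r \<Longrightarrow> norm x < \<delta> / 2"
  proof -
    have "openin (subtopology mtopology V) (T ` ball 0 (\<delta> / 2))"
      using homeomorphic_imp_open_map[OF homeo] by (simp add: topo open_map_def)
    then obtain U where U: "openin mtopology U" "T ` ball 0 (\<delta> / 2) = U \<inter> V"
      by (auto simp: openin_subtopology)
    have "T 0 \<in> U" using U(2) \<delta>(1) by (metis IntE centre_in_ball half_gt_zero imageI)
    then obtain r where "r > 0" "mball (T 0) r \<subseteq> U" using U(1) by (auto simp: openin_mtopology)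
    moreover have "norm x < \<delta> / 2" if "T x \<in> U" for x
    proof -
      have "T x \<in> T ` ball 0 (\<delta> / 2)" using that TV U(2) by blast
      moreover have "inj T" using homeomorphic_imp_injective_map[OF homeo] by simp
      ultimately have "x \<in> ball 0 (\<delta> / 2)" by (simp only: inj_image_mem_iff)
      then show ?thesis by simp
    qed
    moreover have "T x \<in> mball (T 0) r" if "class_norm \<Omega> \<Phi> (T x) < r" for x
      using that TM by (simp add: norm_T)
    ultimately show thesis by (intro that[of r]) blast+
  qed
  \<comment> \<open>All signed sums of these vectors have norm at most \<open>\<delta> / 2 < \<delta>\<close>, but the vectors themselves stay
    away from \<open>0\<close>.\<close>
  define u where "u = linf_unit (\<delta> / 2)"
  have "\<exists>f. f \<in> T (u i)" for i by (rule sobolev_class_nonempty[OF TM[of "u i"]]) blast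
  then obtain f where f: "\<And>i. f i \<in> T (u i)" by metis
  have wd: "weakly_differentiable \<Omega> (f i)" for i
    using sobolev_functionsD(1)[OF sobolev_spaceD(1)[OF TM f]] .
  have meas: "g \<in> borel_measurable (lebesgue_on \<Omega>)" if "g \<in> T x" for g x
    using sobolev_functionsD(3)[OF sobolev_spaceD(1)[OF TM that]] .
  have mem: "(\<lambda>x. sign_sum (\<lambda>i. f i x) n A) \<in> T (sign_sum u n A)" for n A
  proof (induction n)
    case 0
    have "T 0 = class_scale \<Omega> 0 (T (u 0))"
    proof -
      have "0 = linf_scale 0 (u 0)" by (rule bcontfun_eqI) simp
      then show ?thesis using T_scale[of 0 "u 0"] by simp
    qed
    then show ?case
      using class_scale_mem[OF f[of 0] meas[OF f], of 0] by (simp add: sign_sum_def)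
  next
    case (Suc n)
    let ?c = "if n \<in> A then 1 else - 1 :: complex"
    have sum_u: "sign_sum u (Suc n) A = sign_sum u n A + linf_scale ?c (u n)"
      by (rule bcontfun_eqI) (simp add: sign_sum_def plus_bcontfun.rep_eq uminus_bcontfun.rep_eq minus_bcontfun.rep_eq)
    have sum_f: "sign_sum a (Suc n) A = sign_sum a n A + ?c * a n" for a :: "nat \<Rightarrow> complex"
      by (simp add: sign_sum_def)
    have scaled: "(\<lambda>x. ?c * f n x) \<in> T (linf_scale ?c (u n))"
      unfolding T_scale by (rule class_scale_mem[OF f meas[OF f]])
    show ?case
      unfolding sum_u sum_f T_add by (rule class_add_mem[OF Suc scaled meas[OF Suc] meas[OF scaled]])
  qed
  have "SN (\<lambda>x. sign_sum (\<lambda>i. f i x) n A) < 1" for n A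
  proof -
    let ?F = "\<lambda>x. sign_sum (\<lambda>i. f i x) n A"
    have "norm (sign_sum u n A) < \<delta>"
      using norm_sign_sum_linf_unit_le[of "\<delta> / 2" n A] \<delta>(1) by (simp add: u_def)
    then have "enn2real (SN ?F) < 1"
      using \<delta>(2)[of "sign_sum u n A"] sobolev_spaceD(3)[OF TM mem, of n A] by simp
    moreover have "SN ?F < \<infinity>" using sobolev_functionsD(2)[OF sobolev_spaceD(1)[OF TM mem]] .
    ultimately show ?thesis
      by (cases "SN ?F") (auto simp: ennreal_less_one_iff)
  qed
  then have "(\<lambda>i. SN (f i)) \<longlonglongrightarrow> 0"
    by (rule sobolev_norm_tendsto_0_if_signs_bounded[OF d2 wd])
  then have "(\<lambda>i. enn2real (SN (f i))) \<longlonglongrightarrow> 0"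
    by (intro tendsto_enn2real) simp_all
  then have "(\<lambda>i. class_norm \<Omega> \<Phi> (T (u i))) \<longlonglongrightarrow> 0"
    using sobolev_spaceD(3)[OF TM f] by simp
  then have "\<forall>\<^sub>F i in sequentially. class_norm \<Omega> \<Phi> (T (u i)) < r"
    using r(1) by (rule order_tendstoD)
  then obtain i where "class_norm \<Omega> \<Phi> (T (u i)) < r" using eventually_happens by force
  then have "norm (u i) < \<delta> / 2" by (rule r(2))
  then show False using norm_linf_unit_ge[of "\<delta> / 2" i] \<delta>(1) by (simp add: u_def)
qed

end

theorem theorem3p4:
  fixes \<Phi> :: "real \<Rightarrow> real \<Rightarrow> real" and \<alpha> \<beta> :: real
  assumes "\<alpha> < \<beta>"
    and "musielak_orlicz {\<alpha><..<\<beta>} \<Phi>"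
    and "contains_linf_copy {\<alpha><..<\<beta>} \<Phi>"
  shows "\<not> delta2 {\<alpha><..<\<beta>} \<Phi>"
proof -
  interpret musielak_orlicz_interval \<alpha> \<beta> \<Phi> by unfold_locales (rule assms(2))
  show ?thesis using assms(3) by (rule linf_copy_imp_not_delta2)
qed

end
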